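(* For a Lifting Problem with data $(X,(\mathcal U',\mathcal K'),(\mathcal U'',\mathcal K''),\mathcal K'_+,\mathcal K''_-)$ and subspaces $\mathcal G'\subset\mathcal K'_+$, $\mathcal G''\subset\mathcal K''_-$ that are $*$-cyclic for $\mathcal U'$ and $\mathcal U''$ respectively, the Redheffer coefficient-matrix symbol $\left\{\begin{bmatrix}s_0(n)&s_2(n)\\ s_1(n)&s(n)\end{bmatrix}\right\}_{n\in\mathbb Z}$ can be recovered directly from the universal (central) extension $\mathcal U_0$ according to the formula $$\begin{bmatrix}s_0(n)&s_2(n)\\ s_1(n)&s(n)\end{bmatrix}=\begin{bmatrix}i^*_{\mathcal G'',0}\\ i^*_{\widetilde\Delta,0}\,\mathcal U_0^*\end{bmatrix}\mathcal U_0^{*n}\begin{bmatrix}i_{\mathcal G',0}&i_{\widetilde\Delta_*,0}\end{bmatrix},\qquad n\in\mathbb Z.$$ Moreover, $s_2(n)=0$ for $n\le0$, $s_1(n)=0$ and $s(n)=0$ for $n<0$, and also $s(0)=0$.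
   Context: Lifting Problem data: unitary $\mathcal U',\mathcal U''$ on Hilbert spaces $\mathcal K',\mathcal K''$, $*$-cyclic subspaces $\mathcal K'_+\subset\mathcal K'$, $\mathcal K''_-\subset\mathcal K''$ (smallest reducing subspace containing them is the whole space) with $\mathcal U'\mathcal K'_+\subset\mathcal K'_+$, $\mathcal U''^*\mathcal K''_-\subset\mathcal K''_-$, and a contraction $X:\mathcal K'_+\to\mathcal K''_-$ with $X\mathcal U'|_{\mathcal K'_+}=P_{\mathcal K''_-}\mathcal U''X$. Associated objects: $\mathcal H_0$ is the Hilbert space completion of pairs $\begin{bmatrix}k''_-\\ k'_+\end{bmatrix}\in\mathcal K''_-\oplus\mathcal K'_+$ in the inner product $\left\langle\begin{bmatrix}I&X\\ X^*&I\end{bmatrix}\cdot,\cdot\right\rangle$ (zero-norm vectors identified with $0$), with canonical isometric embeddings of $\mathcal K''_-,\mathcal K'_+$; $\mathcal D=\operatorname{clos}\begin{bmatrix}\mathcal K''_-\\ \mathcal U'\mathcal K'_+\end{bmatrix}$, $\mathcal D_*=\operatorname{clos}\begin{bmatrix}\mathcal U''^*\mathcal K''_-\\ \mathcal K'_+\end{bmatrix}$; $V:\mathcal D\to\mathcal D_*$ is the unitary map $\begin{bmatrix}k''_-\\ \mathcal U'k'_+\end{bmatrix}\mapsto\begin{bmatrix}\mathcal U''^*k''_-\\ k'_+\end{bmatrix}$; $\Delta=\mathcal H_0\ominus\mathcal D$, $\Delta_*=\mathcal H_0\ominus\mathcal D_*$, with copies $\widetilde\Delta,\widetilde\Delta_*$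 and unitary identification maps $i_{\widetilde\Delta}:\widetilde\Delta\to\Delta\subset\mathcal H_0$, $i_{\widetilde\Delta_*}:\widetilde\Delta_*\to\Delta_*\subset\mathcal H_0$. Universal unitary colligation: $A_0|_{\mathcal D}=V$, $A_0|_\Delta=0$, $B_0=i_{\widetilde\Delta_*}$, $C_0|_{\mathcal D}=0$, $C_0|_\Delta=i^*_{\widetilde\Delta}$. Redheffer coefficient-matrix symbol (coefficients of the linear-fractional parametrization of symbols of lifts): with $i_{\mathcal G'}:\mathcal G'\to\mathcal H_0$, $i_{\mathcal G''}:\mathcal G''\to\mathcal H_0$ the inclusions through $\mathcal K'_+$, $\mathcal K''_-$, $s_0(n)=i^*_{\mathcal G''}A_0^ni_{\mathcal G'}$ for $n\ge0$ and $s_0(n)=i^*_{\mathcal G''}A_0^{*|n|}i_{\mathcal G'}$ for $n<0$; $s_1(n)=C_0A_0^ni_{\mathcal G'}$ for $n\ge0$, and zero entry for $n<0$; $s_2$ and $s$ are the sequences generating the Toeplitz matrices of the maps $\vec d\mapsto\{i^*_{\mathcal G''}\sum_{k=0}^{n-1}A_0^{n-1-k}B_0d(k)\}_n$ and $\vec d\mapsto\{\sum_{k=0}^{n-1}C_0A_0^{n-1-k}B_0d(k)\}_n$ on $\widetilde\Delta_*$-valued sequences on $\mathbb Z_+$ (outputs extended by $0$ to negative indices), i.e. $s_2(n)=i^*_{\mathcal G''}A_0^{n-1}B_0$, $s(n)=C_0A_0^{n-1}B_0$ for $n\ge1$, with zero entries otherwise. Universal extension: $\mathcal K_0=\mathcal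 H_0\oplus\ell^2_{\widetilde\Delta}(\mathbb Z_-)\oplus\ell^2_{\widetilde\Delta_*}(\mathbb Z_+)$ ($\mathbb Z_-=\{-1,-2,\dots\}$, $\mathbb Z_+=\{0,1,\dots\}$) and $\mathcal U_0$ is the unitary operator with $$\mathcal U_0^*=\begin{bmatrix}A_0&0&i_{\widetilde\Delta_*}i^{(0)*}_{\widetilde\Delta_*}\\ i^{(-1)}_{\widetilde\Delta}i^*_{\widetilde\Delta}&J_-^*&0\\ 0&0&J_+^*\end{bmatrix},$$ where $i^{(n)}$ embeds a coefficient space as sequences supported at $n$, $(J_-^*x)(n)=x(n+1)$ for $n\le-2$, $(J_-^*x)(-1)=0$, $(J_+^*x)(n)=x(n+1)$ for $n\ge0$. $i_{\widetilde\Delta,0}:\widetilde\Delta\to\mathcal K_0$ is $i^{(-1)}_{\widetilde\Delta}$ into the second summand, $i_{\widetilde\Delta_*,0}:\widetilde\Delta_*\to\mathcal K_0$ is $i^{(0)}_{\widetilde\Delta_*}$ into the third summand, and $i_{\mathcal G',0},i_{\mathcal G'',0}$ are $i_{\mathcal G'},i_{\mathcal G''}$ followed by the inclusion $\mathcal H_0\subset\mathcal K_0$. *)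

theory Defs
  imports "HOL-Analysis.Analysis"
begin

section \<open>Complex Hilbert spaces\<close>

text \<open>
  The inner product is linear in the first argument. The norm and the topology are those of
  the underlying real inner product space.
\<close>

class complex_inner = real_inner +
  fixes scaleC :: "complex \<Rightarrow> 'a \<Rightarrow> 'a"  (infixr \<open>*\<^sub>C\<close> 75)
    and cinner :: "'a \<Rightarrow> 'a \<Rightarrow> complex"
  assumes scaleC_add_right: "c *\<^sub>C (x + y) = c *\<^sub>C x + c *\<^sub>C y"
    and scaleC_add_left: "(c + d) *\<^sub>C x = c *\<^sub>C x + d *\<^sub>C x"
    and scaleC_scaleC: "c *\<^sub>C d *\<^sub>C x = (c * d) *\<^sub>C x"
    and scaleR_eq_scaleC: "scaleR r x = complex_of_real r *\<^sub>C x"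
    and cinner_commute: "cinner x y = cnj (cinner y x)"
    and cinner_add_left: "cinner (x + y) z = cinner x z + cinner y z"
    and cinner_scaleC_left: "cinner (c *\<^sub>C x) y = c * cinner x y"
    and inner_eq_Re_cinner: "inner x y = Re (cinner x y)"

class chilbert_space = complex_inner + complete_space

lemma scaleC_one [simp]: "1 *\<^sub>C x = (x::'a::complex_inner)"
  using scaleR_eq_scaleC[of 1 x] by simp

lemma scaleC_zero_left [simp]: "0 *\<^sub>C x = (0::'a::complex_inner)"
  using scaleR_eq_scaleC[of 0 x] by simp

lemma scaleC_zero_right [simp]: "c *\<^sub>C 0 = (0::'a::complex_inner)"
  using scaleC_add_right[of c 0 "0::'a"] by simp

lemma scaleC_minus1: "(-1) *\<^sub>C x = - (x::'a::complex_inner)"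
  using scaleR_eq_scaleC[of "-1" x] by simp

lemma scaleC_minus_right: "c *\<^sub>C (- x) = - (c *\<^sub>C (x::'a::complex_inner))"
  using scaleC_add_right[of c x "- x"] by (simp add: eq_neg_iff_add_eq_0 add.commute)

lemma scaleC_diff_right: "c *\<^sub>C (x - y) = c *\<^sub>C x - c *\<^sub>C (y::'a::complex_inner)"
  using scaleC_add_right[of c x "- y"] by (simp add: scaleC_minus_right)

lemma cinner_add_right: "cinner x (y + z) = cinner x y + cinner (x::'a::complex_inner) z"
  by (metis cinner_add_left cinner_commute complex_cnj_add)

lemma cinner_scaleC_right: "cinner x (c *\<^sub>C y) = cnj c * cinner (x::'a::complex_inner) y"
  by (metis cinner_scaleC_left cinner_commute complex_cnj_mult)

lemma cinner_zero_left [simp]: "cinner 0 (y::'a::complex_inner) = 0"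
  using cinner_scaleC_left[of 0 0 y] by simp

lemma cinner_zero_right [simp]: "cinner (x::'a::complex_inner) 0 = 0"
  using cinner_scaleC_right[of x 0 0] by simp

lemma cinner_minus_left: "cinner (- x) y = - cinner (x::'a::complex_inner) y"
  by (metis cinner_scaleC_left mult_minus1 scaleC_minus1)

lemma cinner_minus_right: "cinner x (- y) = - cinner (x::'a::complex_inner) y"
  by (metis cinner_commute cinner_minus_left complex_cnj_minus)

lemma cinner_diff_left: "cinner (x - y) z = cinner x z - cinner (y::'a::complex_inner) z"
  using cinner_add_left[of x "- y" z] by (simp add: cinner_minus_left)

lemma cinner_diff_right: "cinner x (y - z) = cinner x y - cinner (x::'a::complex_inner) z"
  using cinner_add_right[of x y "- z"] by (simp add: cinner_minus_right)

lemma cinner_self: "cinner x x = complex_of_real ((norm (x::'a::complex_inner))\<^sup>2)"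
proof (rule complex_eqI)
  show "Re (cinner x x) = Re (complex_of_real ((norm x)\<^sup>2))"
    by (simp flip: inner_eq_Re_cinner add: power2_norm_eq_inner)
  have "Im (cinner x x) = - Im (cinner x x)"
    by (metis cinner_commute cnj.simps(2))
  then show "Im (cinner x x) = Im (complex_of_real ((norm x)\<^sup>2))"
    by simp
qed

lemma cinner_self_eq_0 [simp]: "cinner x x = 0 \<longleftrightarrow> x = (0::'a::complex_inner)"
  by (simp add: cinner_self)

lemma norm_scaleC: "norm (c *\<^sub>C x) = cmod c * norm (x::'a::complex_inner)"
proof -
  have "complex_of_real ((norm (c *\<^sub>C x))\<^sup>2) = complex_of_real ((cmod c * norm x)\<^sup>2)"
    by (simp only: cinner_self [symmetric] cinner_scaleC_left cinner_scaleC_right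
        power_mult_distrib of_real_mult complex_norm_square mult_ac)
  then show ?thesis
    by (metis mult_nonneg_nonneg norm_ge_zero of_real_eq_iff power2_eq_iff_nonneg)
qed

lemma cmod_cinner_le: "cmod (cinner x y) \<le> norm x * norm (y::'a::complex_inner)"
proof -
  obtain u where u: "cmod u = 1" "u * cinner x y = complex_of_real (cmod (cinner x y))"
  proof (cases "cinner x y = 0")
    case False
    show thesis
    proof
      let ?u = "cnj (cinner x y) / complex_of_real (cmod (cinner x y))"
      show "cmod ?u = 1" using False by (simp add: norm_divide)
      show "?u * cinner x y = complex_of_real (cmod (cinner x y))"
        using False by (simp add: complex_norm_square[symmetric] power2_eq_square field_simps)
    qed
  qed (auto intro: that[of 1])
  have "cmod (cinner x y) = inner (u *\<^sub>C x) y"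
    using u(2) by (simp add: inner_eq_Re_cinner cinner_scaleC_left)
  also have "\<dots> \<le> norm (u *\<^sub>C x) * norm y"
    by (rule norm_cauchy_schwarz)
  finally show ?thesis
    by (simp add: norm_scaleC u(1))
qed

instantiation complex :: chilbert_space
begin

definition scaleC_complex :: "complex \<Rightarrow> complex \<Rightarrow> complex" where
  "scaleC_complex c x = c * x"

definition cinner_complex :: "complex \<Rightarrow> complex \<Rightarrow> complex" where
  "cinner_complex x y = x * cnj y"

instance
  by standard
    (simp_all add: scaleC_complex_def cinner_complex_def algebra_simps scaleR_conv_of_real
      inner_complex_def)

end

instantiation prod :: (complex_inner, complex_inner) complex_inner
begin

definition scaleC_prod :: "complex \<Rightarrow> 'a \<times> 'b \<Rightarrow> 'a \<times> 'b" where
  "scaleC_prod c x = (c *\<^sub>C fst x, c *\<^sub>C snd x)"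

definition cinner_prod :: "'a \<times> 'b \<Rightarrow> 'a \<times> 'b \<Rightarrow> complex" where
  "cinner_prod x y = cinner (fst x) (fst y) + cinner (snd x) (snd y)"

instance
proof
  fix x y z :: "'a \<times> 'b" and c d :: complex and r :: real
  show "cinner x y = cnj (cinner y x)"
    by (simp add: cinner_prod_def flip: cinner_commute)
  show "scaleR r x = complex_of_real r *\<^sub>C x"
    by (simp add: scaleC_prod_def scaleR_prod_def scaleR_eq_scaleC)
qed (simp_all add: scaleC_prod_def cinner_prod_def inner_prod_def scaleC_add_right
    scaleC_add_left scaleC_scaleC cinner_add_left cinner_scaleC_left inner_eq_Re_cinner
    algebra_simps)

end

instance prod :: (chilbert_space, chilbert_space) chilbert_space ..


section \<open>Square-summable two-sided sequences\<close>

lemma norm_add_sq_le: "(norm (x + y))\<^sup>2 \<le> 2 * (norm x)\<^sup>2 + 2 * (norm (y::'a::real_inner))\<^sup>2"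
proof -
  have "(norm (x + y))\<^sup>2 + (norm (x - y))\<^sup>2 = 2 * (norm x)\<^sup>2 + 2 * (norm y)\<^sup>2"
    by (simp add: power2_norm_eq_inner inner_add_left inner_add_right inner_diff_left
        inner_diff_right inner_commute)
  then show ?thesis
    by (smt (verit) zero_le_power2)
qed

typedef (overloaded) 'a ell2 =
  "{f :: int \<Rightarrow> 'a::complex_inner. (\<lambda>n. (norm (f n))\<^sup>2) summable_on UNIV}"
  morphisms coord Abs_ell2
  by (rule exI[of _ "\<lambda>_. 0"]) simp

setup_lifting type_definition_ell2

lemma coord_square_summable: "(\<lambda>n. (norm (coord x n))\<^sup>2) summable_on UNIV"
  using coord[of x] by simp

lemma cinner_summable_on:
  fixes f g :: "int \<Rightarrow> 'a::complex_inner"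
  assumes "(\<lambda>n. (norm (f n))\<^sup>2) summable_on UNIV" "(\<lambda>n. (norm (g n))\<^sup>2) summable_on UNIV"
  shows "(\<lambda>n. cinner (f n) (g n)) summable_on UNIV"
proof (rule abs_summable_summable, rule Infinite_Sum.summable_on_comparison_test)
  show "(\<lambda>n. (norm (f n))\<^sup>2 + (norm (g n))\<^sup>2) summable_on UNIV"
    by (intro summable_on_add assms)
  fix n
  have "norm (cinner (f n) (g n)) \<le> norm (f n) * norm (g n)"
    by (rule cmod_cinner_le)
  also have "\<dots> \<le> (norm (f n))\<^sup>2 + (norm (g n))\<^sup>2"
  proof -
    have "0 \<le> norm (f n) * norm (g n)" by simp
    then show ?thesis
      using sum_squares_bound[of "norm (f n)" "norm (g n)"] by (simp only: mult.assoc)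
  qed
  finally show "norm (cinner (f n) (g n)) \<le> (norm (f n))\<^sup>2 + (norm (g n))\<^sup>2" .
qed auto

instantiation ell2 :: (complex_inner) complex_inner
begin

lift_definition zero_ell2 :: "'a ell2" is "\<lambda>_. 0" by simp

lift_definition plus_ell2 :: "'a ell2 \<Rightarrow> 'a ell2 \<Rightarrow> 'a ell2" is "\<lambda>f g n. f n + g n"
proof -
  fix f g :: "int \<Rightarrow> 'a"
  assume a: "(\<lambda>n. (norm (f n))\<^sup>2) summable_on UNIV" "(\<lambda>n. (norm (g n))\<^sup>2) summable_on UNIV"
  have "(\<lambda>n. 2 * (norm (f n))\<^sup>2 + 2 * (norm (g n))\<^sup>2) summable_on UNIV"
    by (intro summable_on_add summable_on_cmult_right a)
  then show "(\<lambda>n. (norm (f n + g n))\<^sup>2) summable_on UNIV"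
    by (rule Infinite_Sum.summable_on_comparison_test) (auto intro: norm_add_sq_le)
qed

lift_definition uminus_ell2 :: "'a ell2 \<Rightarrow> 'a ell2" is "\<lambda>f n. - f n" by simp

definition minus_ell2 :: "'a ell2 \<Rightarrow> 'a ell2 \<Rightarrow> 'a ell2" where
  "minus_ell2 x y = x + (- y)"

lift_definition scaleC_ell2 :: "complex \<Rightarrow> 'a ell2 \<Rightarrow> 'a ell2" is "\<lambda>c f n. c *\<^sub>C f n"
  by (auto simp: norm_scaleC power_mult_distrib intro: summable_on_cmult_right)

definition scaleR_ell2 :: "real \<Rightarrow> 'a ell2 \<Rightarrow> 'a ell2" where
  "scaleR_ell2 r x = complex_of_real r *\<^sub>C x"

definition cinner_ell2 :: "'a ell2 \<Rightarrow> 'a ell2 \<Rightarrow> complex" where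
  "cinner_ell2 x y = (\<Sum>\<^sub>\<infinity>n. cinner (coord x n) (coord y n))"

definition inner_ell2 :: "'a ell2 \<Rightarrow> 'a ell2 \<Rightarrow> real" where
  "inner_ell2 x y = Re (cinner x y)"

definition norm_ell2 :: "'a ell2 \<Rightarrow> real" where
  "norm_ell2 x = sqrt (inner x x)"

definition sgn_ell2 :: "'a ell2 \<Rightarrow> 'a ell2" where
  "sgn_ell2 x = inverse (norm x) *\<^sub>R x"

definition dist_ell2 :: "'a ell2 \<Rightarrow> 'a ell2 \<Rightarrow> real" where
  "dist_ell2 x y = norm (x - y)"

definition uniformity_ell2 :: "('a ell2 \<times> 'a ell2) filter" where
  "uniformity_ell2 = (INF e\<in>{0<..}. principal {(x, y). dist x y < e})"

definition open_ell2 :: "'a ell2 set \<Rightarrow> bool" where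
  "open_ell2 S \<longleftrightarrow> (\<forall>x\<in>S. \<forall>\<^sub>F (x', y) in uniformity. x' = x \<longrightarrow> y \<in> S)"

instance
proof
  fix x y z :: "'a ell2" and a b :: real and c d :: complex and S :: "'a ell2 set"
  show "x + y + z = x + (y + z)" by transfer (simp add: add.assoc)
  show "x + y = y + x" by transfer (simp add: add.commute)
  show "0 + x = x" by transfer simp
  show "- x + x = 0" by transfer simp
  show "x - y = x + - y" by (simp add: minus_ell2_def)
  have addr: "c *\<^sub>C (u + v) = c *\<^sub>C u + c *\<^sub>C v" for c and u v :: "'a ell2"
    by transfer (simp add: scaleC_add_right)
  have addl: "(c + d) *\<^sub>C u = c *\<^sub>C u + d *\<^sub>C u" for c d and u :: "'a ell2"
    by transfer (simp add: scaleC_add_left)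
  have scsc: "c *\<^sub>C d *\<^sub>C u = (c * d) *\<^sub>C u" for c d and u :: "'a ell2"
    by transfer (simp add: scaleC_scaleC)
  show "c *\<^sub>C (x + y) = c *\<^sub>C x + c *\<^sub>C y" by (rule addr)
  show "(c + d) *\<^sub>C x = c *\<^sub>C x + d *\<^sub>C x" by (rule addl)
  show "c *\<^sub>C d *\<^sub>C x = (c * d) *\<^sub>C x" by (rule scsc)
  show "a *\<^sub>R x = complex_of_real a *\<^sub>C x" by (simp add: scaleR_ell2_def)
  show "a *\<^sub>R (x + y) = a *\<^sub>R x + a *\<^sub>R y" by (simp add: scaleR_ell2_def addr)
  show "(a + b) *\<^sub>R x = a *\<^sub>R x + b *\<^sub>R x" by (simp add: scaleR_ell2_def addl)
  show "a *\<^sub>R b *\<^sub>R x = (a * b) *\<^sub>R x" by (simp add: scaleR_ell2_def scsc)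
  have one: "1 *\<^sub>C x = x" by transfer simp
  show "1 *\<^sub>R x = x" by (simp add: scaleR_ell2_def one)
  show "dist x y = norm (x - y)" by (rule dist_ell2_def)
  show "sgn x = inverse (norm x) *\<^sub>R x" by (rule sgn_ell2_def)
  show "uniformity = (INF e\<in>{0<..}. principal {(x, y). dist x (y::'a ell2) < e})"
    by (rule uniformity_ell2_def)
  show "open S = (\<forall>x\<in>S. \<forall>\<^sub>F (x', y) in uniformity. x' = x \<longrightarrow> y \<in> S)"
    by (rule open_ell2_def)
  have comm: "cinner u v = cnj (cinner v u)" for u v :: "'a ell2"
    unfolding cinner_ell2_def infsum_cnj[symmetric]
    by (rule infsum_cong) (rule cinner_commute)
  have sm: "(\<lambda>n. cinner (coord u n) (coord v n)) summable_on UNIV" for u v :: "'a ell2"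
    by (intro cinner_summable_on coord_square_summable)
  have cadd: "cinner (x + y) z = cinner x z + cinner y z"
    unfolding cinner_ell2_def
    by (simp add: plus_ell2.rep_eq cinner_add_left infsum_add[OF sm sm])
  have csc: "cinner (c *\<^sub>C x) y = c * cinner x y" for c
    unfolding cinner_ell2_def
    by (simp add: scaleC_ell2.rep_eq cinner_scaleC_left infsum_cmult_right[OF sm])
  show "cinner x y = cnj (cinner y x)" by (rule comm)
  show "cinner (x + y) z = cinner x z + cinner y z" by (rule cadd)
  show "cinner (c *\<^sub>C x) y = c * cinner x y" by (rule csc)
  show "inner x y = Re (cinner x y)" by (rule inner_ell2_def)
  show "inner x y = inner y x"
    unfolding inner_ell2_def by (metis comm cnj.simps(1))
  show "inner (x + y) z = inner x z + inner y z" by (simp add: inner_ell2_def cadd)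
  show "inner (a *\<^sub>R x) y = a * inner x y" by (simp add: inner_ell2_def scaleR_ell2_def csc)
  have self: "inner x x = (\<Sum>\<^sub>\<infinity>n. (norm (coord x n))\<^sup>2)"
  proof -
    have "inner x x = (\<Sum>\<^sub>\<infinity>n. Re (cinner (coord x n) (coord x n)))"
      unfolding inner_ell2_def cinner_ell2_def by (rule infsum_Re[OF sm, symmetric])
    then show ?thesis by (simp add: cinner_self)
  qed
  show "0 \<le> inner x x" unfolding self by (intro infsum_nonneg) simp
  show "inner x x = 0 \<longleftrightarrow> x = 0"
  proof
    assume "inner x x = 0"
    then have "(norm (coord x n))\<^sup>2 = 0" for n
      using nonneg_infsum_le_0D[of "\<lambda>n. (norm (coord x n))\<^sup>2" UNIV n]
        coord_square_summable[of x] by (simp add: self)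
    then have "coord x n = 0" for n by simp
    then show "x = 0" by transfer auto
  next
    assume "x = 0"
    then show "inner x x = 0" by (simp add: inner_ell2_def cinner_ell2_def zero_ell2.rep_eq)
  qed
  show "norm x = sqrt (inner x x)" by (rule norm_ell2_def)
qed

end


lemma ell2_norm_sq: "(norm x)\<^sup>2 = (\<Sum>\<^sub>\<infinity>n. (norm (coord x n))\<^sup>2)"
proof -
  have sm: "(\<lambda>n. cinner (coord x n) (coord x n)) summable_on UNIV"
    by (intro cinner_summable_on coord_square_summable)
  have "(norm x)\<^sup>2 = Re (cinner x x)"
    by (simp add: power2_norm_eq_inner inner_eq_Re_cinner)
  also have "\<dots> = (\<Sum>\<^sub>\<infinity>n. Re (cinner (coord x n) (coord x n)))"
    unfolding cinner_ell2_def by (rule infsum_Re[OF sm, symmetric])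
  finally show ?thesis by (simp add: cinner_self)
qed

lemma ell2_finite_sum_le: "finite F \<Longrightarrow> (\<Sum>n\<in>F. (norm (coord x n))\<^sup>2) \<le> (norm x)\<^sup>2"
  unfolding ell2_norm_sq by (intro finite_sum_le_infsum coord_square_summable) auto

lemma coord_diff: "coord (x - y) n = coord x n - coord y n"
  unfolding minus_ell2_def plus_ell2.rep_eq uminus_ell2.rep_eq by simp

instance ell2 :: (chilbert_space) chilbert_space
proof
  fix X :: "nat \<Rightarrow> 'a ell2"
  assume X: "Cauchy X"
  have coord_le: "norm (coord x n) \<le> norm x" for x :: "'a ell2" and n
    using ell2_finite_sum_le[of "{n}" x] by simp
  have "Cauchy (\<lambda>i. coord (X i) n)" for n
  proof (rule metric_CauchyI)
    fix e :: real assume "0 < e"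
    then obtain N where "\<And>i j. i \<ge> N \<Longrightarrow> j \<ge> N \<Longrightarrow> dist (X i) (X j) < e"
      using metric_CauchyD[OF X] by blast
    then have "dist (coord (X i) n) (coord (X j) n) < e" if "i \<ge> N" "j \<ge> N" for i j
      using coord_le[of "X i - X j" n] that by (fastforce simp: dist_norm coord_diff)
    then show "\<exists>N. \<forall>i\<ge>N. \<forall>j\<ge>N. dist (coord (X i) n) (coord (X j) n) < e" by blast
  qed
  then have "\<forall>n. \<exists>l. (\<lambda>i. coord (X i) n) \<longlonglongrightarrow> l"
    using Cauchy_convergent_iff convergent_def by blast
  then obtain f where f: "\<And>n. (\<lambda>i. coord (X i) n) \<longlonglongrightarrow> f n" by metis
  have bound: "\<exists>N. \<forall>i\<ge>N. \<forall>F. finite F \<longrightarrow> (\<Sum>n\<in>F. (norm (coord (X i) n - f n))\<^sup>2) \<le> e\<^sup>2"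
    if e: "0 < e" for e
  proof -
    obtain N where N: "\<And>i j. i \<ge> N \<Longrightarrow> j \<ge> N \<Longrightarrow> dist (X i) (X j) < e"
      using metric_CauchyD[OF X e] by blast
    have "(\<Sum>n\<in>F. (norm (coord (X i) n - f n))\<^sup>2) \<le> e\<^sup>2" if i: "i \<ge> N" and F: "finite F" for i F
    proof (rule LIMSEQ_le_const2)
      show "(\<lambda>j. \<Sum>n\<in>F. (norm (coord (X i) n - coord (X j) n))\<^sup>2)
          \<longlonglongrightarrow> (\<Sum>n\<in>F. (norm (coord (X i) n - f n))\<^sup>2)"
        by (intro tendsto_intros f)
      have "(\<Sum>n\<in>F. (norm (coord (X i) n - coord (X j) n))\<^sup>2) \<le> e\<^sup>2" if j: "j \<ge> N" for j
      proof -
        have "(norm (X i - X j))\<^sup>2 \<le> e\<^sup>2"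
          using N[OF i j] by (intro power_mono) (simp_all add: dist_norm)
        then show ?thesis using ell2_finite_sum_le[OF F, of "X i - X j"] by (simp add: coord_diff)
      qed
      then show "\<exists>N. \<forall>j\<ge>N. (\<Sum>n\<in>F. (norm (coord (X i) n - coord (X j) n))\<^sup>2) \<le> e\<^sup>2" by blast
    qed
    then show ?thesis by blast
  qed
  have diff_sm: "(\<lambda>n. (norm (coord (X i) n - f n))\<^sup>2) summable_on UNIV"
    if "\<forall>F. finite F \<longrightarrow> (\<Sum>n\<in>F. (norm (coord (X i) n - f n))\<^sup>2) \<le> e\<^sup>2" for i e
    using that by (intro nonneg_bdd_above_summable_on bdd_aboveI) auto
  obtain i where i: "\<forall>F. finite F \<longrightarrow> (\<Sum>n\<in>F. (norm (coord (X i) n - f n))\<^sup>2) \<le> 1\<^sup>2"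
    using bound[of 1] by auto
  have "(\<lambda>n. 2 * (norm (coord (X i) n))\<^sup>2 + 2 * (norm (coord (X i) n - f n))\<^sup>2) summable_on UNIV"
    by (intro summable_on_add summable_on_cmult_right coord_square_summable diff_sm[OF i])
  then have "(\<lambda>n. (norm (f n))\<^sup>2) summable_on UNIV"
  proof (rule Infinite_Sum.summable_on_comparison_test)
    fix n
    show "(norm (f n))\<^sup>2 \<le> 2 * (norm (coord (X i) n))\<^sup>2 + 2 * (norm (coord (X i) n - f n))\<^sup>2"
      using norm_add_sq_le[of "coord (X i) n" "f n - coord (X i) n"]
      by (simp add: norm_minus_commute)
  qed simp
  then have cf: "coord (Abs_ell2 f) = f" by (simp add: Abs_ell2_inverse)
  have "X \<longlonglongrightarrow> Abs_ell2 f"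
  proof (rule metric_LIMSEQ_I)
    fix r :: real assume r: "0 < r"
    obtain N where N: "\<And>i F. i \<ge> N \<Longrightarrow> finite F \<Longrightarrow>
        (\<Sum>n\<in>F. (norm (coord (X i) n - f n))\<^sup>2) \<le> (r/2)\<^sup>2"
      using bound[of "r/2"] r by auto
    have "dist (X i) (Abs_ell2 f) < r" if "i \<ge> N" for i
    proof -
      have "(norm (X i - Abs_ell2 f))\<^sup>2 \<le> (r/2)\<^sup>2"
        unfolding ell2_norm_sq coord_diff cf
      proof (rule infsum_le_finite_sums)
        show "(\<lambda>n. (norm (coord (X i) n - f n))\<^sup>2) summable_on UNIV"
          by (rule diff_sm[of i "r/2"]) (use N[OF that] in blast)
      qed (rule N[OF that])
      then have "norm (X i - Abs_ell2 f) \<le> r/2" by (rule power2_le_imp_le) (use r in simp)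
      then show ?thesis using r by (simp add: dist_norm)
    qed
    then show "\<exists>N. \<forall>i\<ge>N. dist (X i) (Abs_ell2 f) < r" by blast
  qed
  then show "convergent X" by (rule convergentI)
qed

lemma ell2_shift_square_summable:
  assumes "(\<lambda>n. (norm (f n))\<^sup>2) summable_on (UNIV :: int set)"
  shows "(\<lambda>n. (norm (if P n then f (n + 1) else 0))\<^sup>2) summable_on UNIV"
proof (rule Infinite_Sum.summable_on_comparison_test)
  have "bij (\<lambda>n::int. n + 1)"
    by (rule o_bij[of "\<lambda>n. n - 1"]) auto
  then show "(\<lambda>n. (norm (f (n + 1)))\<^sup>2) summable_on UNIV"
    using assms by (subst summable_on_reindex_bij_betw[of "\<lambda>n. n + 1" UNIV UNIV]) auto
qed auto

lift_definition ell2_single :: "int \<Rightarrow> 'a \<Rightarrow> 'a::complex_inner ell2"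
  is "\<lambda>n x m. if m = n then x else 0"
  by (rule finite_nonzero_values_imp_summable_on) simp

lift_definition Jminus_adj :: "'a::complex_inner ell2 \<Rightarrow> 'a ell2"
  is "\<lambda>f n. if n \<le> -2 then f (n + 1) else 0"
  by (rule ell2_shift_square_summable)

lift_definition Jplus_adj :: "'a::complex_inner ell2 \<Rightarrow> 'a ell2"
  is "\<lambda>f n. if n \<ge> 0 then f (n + 1) else 0"
  by (rule ell2_shift_square_summable)


section \<open>Subspaces, adjoints and orthogonal projections\<close>

definition csubspace :: "'a::complex_inner set \<Rightarrow> bool" where
  "csubspace S \<longleftrightarrow> 0 \<in> S \<and> (\<forall>x\<in>S. \<forall>y\<in>S. x + y \<in> S) \<and> (\<forall>c. \<forall>x\<in>S. c *\<^sub>C x \<in> S)"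

definition closed_csubspace :: "'a::complex_inner set \<Rightarrow> bool" where
  "closed_csubspace S \<longleftrightarrow> csubspace S \<and> closed S"

definition clinear_on :: "'a::complex_inner set \<Rightarrow> ('a \<Rightarrow> 'b::complex_inner) \<Rightarrow> bool" where
  "clinear_on S f \<longleftrightarrow>
     (\<forall>x\<in>S. \<forall>y\<in>S. f (x + y) = f x + f y) \<and> (\<forall>c. \<forall>x\<in>S. f (c *\<^sub>C x) = c *\<^sub>C f x)"

definition isometric_on :: "'a::complex_inner set \<Rightarrow> ('a \<Rightarrow> 'b::complex_inner) \<Rightarrow> bool" where
  "isometric_on S f \<longleftrightarrow> clinear_on S f \<and> (\<forall>x\<in>S. \<forall>y\<in>S. cinner (f x) (f y) = cinner x y)"

definition unitary :: "('a::complex_inner \<Rightarrow> 'a) \<Rightarrow> bool" where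
  "unitary U \<longleftrightarrow> isometric_on UNIV U \<and> surj U"

text \<open>
  The adjoint of an operator \<open>F\<close> whose domain is the closed subspace \<open>S\<close>; its values lie
  in \<open>S\<close>.
\<close>

definition cadj :: "'a::complex_inner set \<Rightarrow> ('a \<Rightarrow> 'b::complex_inner) \<Rightarrow> 'b \<Rightarrow> 'a" where
  "cadj S F y = (THE x. x \<in> S \<and> (\<forall>s\<in>S. cinner (F s) y = cinner s x))"

definition oproj :: "'a::complex_inner set \<Rightarrow> 'a \<Rightarrow> 'a" where
  "oproj M x = (THE m. m \<in> M \<and> (\<forall>y\<in>M. cinner (x - m) y = 0))"

definition star_cyclic :: "('a::complex_inner \<Rightarrow> 'a) \<Rightarrow> 'a set \<Rightarrow> bool" where
  "star_cyclic U S \<longleftrightarrow>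
     (\<forall>M. closed_csubspace M \<and> U ` M \<subseteq> M \<and> cadj UNIV U ` M \<subseteq> M \<and> S \<subseteq> M \<longrightarrow> M = UNIV)"

lemma csubspace_minus: "csubspace S \<Longrightarrow> x \<in> S \<Longrightarrow> - x \<in> S"
  unfolding csubspace_def by (metis scaleC_minus1)

lemma csubspace_diff: "csubspace S \<Longrightarrow> x \<in> S \<Longrightarrow> y \<in> S \<Longrightarrow> x - y \<in> S"
  using csubspace_minus[of S y] unfolding csubspace_def by (metis add_uminus_conv_diff)

lemma ortho_decomposition:
  fixes h :: "'a::chilbert_space"
  assumes M: "closed_csubspace M"
  shows "\<exists>m\<in>M. \<forall>y\<in>M. cinner (h - m) y = 0"
proof -
  have sub: "csubspace M" and cl: "closed M" using M by (auto simp: closed_csubspace_def)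
  have M0: "0 \<in> M" and Madd: "\<And>x y. x \<in> M \<Longrightarrow> y \<in> M \<Longrightarrow> x + y \<in> M"
    and Msc: "\<And>c x. x \<in> M \<Longrightarrow> c *\<^sub>C x \<in> M"
    using sub by (auto simp: csubspace_def)
  have MscR: "r *\<^sub>R x \<in> M" if "x \<in> M" for r x
    using Msc[OF that] by (simp add: scaleR_eq_scaleC)
  define d where "d = (INF m\<in>M. (norm (h - m))\<^sup>2)"
  have bdd: "bdd_below ((\<lambda>m. (norm (h - m))\<^sup>2) ` M)"
    by (rule bdd_belowI[of _ 0]) auto
  have dle: "d \<le> (norm (h - m))\<^sup>2" if "m \<in> M" for m
    unfolding d_def by (rule cINF_lower[OF bdd that])
  have "\<exists>m\<in>M. (norm (h - m))\<^sup>2 < d + 1 / real (Suc n)" for n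
  proof -
    have "d < d + 1 / real (Suc n)" by simp
    then show ?thesis unfolding d_def using M0 bdd by (subst (asm) (1) cINF_less_iff) auto
  qed
  then obtain m where mM: "\<And>n. m n \<in> M"
    and md: "\<And>n. (norm (h - m n))\<^sup>2 < d + 1 / real (Suc n)"
    by metis
  have par: "(norm (m i - m j))\<^sup>2 \<le> 2 / real (Suc i) + 2 / real (Suc j)" for i j
  proof -
    let ?u = "h - m i" and ?v = "h - m j"
    have "(1/2) *\<^sub>R (m i + m j) \<in> M" by (intro MscR Madd mM)
    note d4 = dle[OF this]
    have "h - (1/2) *\<^sub>R (m i + m j) = (1/2) *\<^sub>R (?u + ?v)"
      by (simp add: scaleR_add_right scaleR_diff_right)
        (metis (no_types) field_sum_of_halves scaleR_left_distrib scaleR_one)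
    then have "4 * d \<le> (norm (?u + ?v))\<^sup>2"
      using d4 by (simp add: power_divide)
    moreover have "(norm (?u + ?v))\<^sup>2 + (norm (?u - ?v))\<^sup>2 = 2 * (norm ?u)\<^sup>2 + 2 * (norm ?v)\<^sup>2"
      by (simp only: power2_norm_eq_inner inner_add_left inner_add_right inner_diff_left
          inner_diff_right inner_commute) (simp add: inner_commute algebra_simps)
    moreover have "norm (m i - m j) = norm (?u - ?v)"
      by (simp add: norm_minus_commute)
    moreover have "2 * (1 / real (Suc n)) = 2 / real (Suc n)" for n by simp
    ultimately show ?thesis using md[of i] md[of j]
      by (simp only: times_divide_eq_right mult_1_right)
  qed
  have "Cauchy m"
  proof (rule metric_CauchyI)
    fix e :: real assume e: "0 < e"
    obtain N where N: "4 / e\<^sup>2 < real N" using reals_Archimedean2 by blast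
    have "dist (m i) (m j) < e" if ij: "i \<ge> N" "j \<ge> N" for i j
    proof -
      have "0 < 4 / e\<^sup>2" using e by simp
      then have Npos: "0 < real N" using N by linarith
      have "2 / real (Suc i) \<le> 2 / real N" "2 / real (Suc j) \<le> 2 / real N"
        using ij Npos by (auto intro!: divide_left_mono)
      then have "(norm (m i - m j))\<^sup>2 \<le> 4 / real N" using par[of i j] by simp
      also have "\<dots> < e\<^sup>2" using N Npos e by (simp add: field_simps)
      finally show ?thesis
        unfolding dist_norm by (rule power2_less_imp_less) (use e in simp)
    qed
    then show "\<exists>N. \<forall>i\<ge>N. \<forall>j\<ge>N. dist (m i) (m j) < e" by blast
  qed
  then obtain p where p: "m \<longlonglongrightarrow> p" using Cauchy_convergent_iff convergent_def by blast
  have pM: "p \<in> M" using cl p mM by (meson closed_sequentially)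
  have "(norm (h - p))\<^sup>2 \<le> d"
  proof (rule LIMSEQ_le)
    show "(\<lambda>n. (norm (h - m n))\<^sup>2) \<longlonglongrightarrow> (norm (h - p))\<^sup>2" by (intro tendsto_intros p)
    show "(\<lambda>n. d + 1 / real (Suc n)) \<longlonglongrightarrow> d"
      using tendsto_add[OF tendsto_const LIMSEQ_inverse_real_of_nat, of d]
      by (simp add: inverse_eq_divide)
    show "\<exists>N. \<forall>n\<ge>N. (norm (h - m n))\<^sup>2 \<le> d + 1 / real (Suc n)"
      using md less_imp_le by blast
  qed
  then have min: "(norm (h - p))\<^sup>2 \<le> (norm (h - y))\<^sup>2" if "y \<in> M" for y
    using dle[OF that] by linarith
  have expand: "(norm (z - t *\<^sub>R y))\<^sup>2
      = (norm z)\<^sup>2 - 2 * t * inner z y + t\<^sup>2 * (norm y)\<^sup>2" for z y :: 'a and t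
    by (simp add: power2_norm_eq_inner inner_diff_left inner_diff_right inner_commute)
      (simp add: power2_eq_square)
  have re: "inner (h - p) y = 0" if y: "y \<in> M" for y
  proof (cases "y = 0")
    case False
    let ?z = "h - p" and ?t = "inner (h - p) y / (norm y)\<^sup>2"
    have "(norm ?z)\<^sup>2 \<le> (norm (?z - ?t *\<^sub>R y))\<^sup>2"
      using min[of "p + ?t *\<^sub>R y"] Madd[OF pM MscR[OF y]] by (simp add: algebra_simps)
    also have "(norm (?z - ?t *\<^sub>R y))\<^sup>2
        = (norm ?z)\<^sup>2 - 2 * ?t * inner ?z y + ?t\<^sup>2 * (norm y)\<^sup>2"
      by (rule expand)
    also have "\<dots> = (norm ?z)\<^sup>2 - (inner ?z y)\<^sup>2 / (norm y)\<^sup>2"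
      using False by (simp add: power2_eq_square field_simps)
    finally have "(inner ?z y)\<^sup>2 / (norm y)\<^sup>2 \<le> 0" by simp
    then show ?thesis using False by (simp add: divide_le_0_iff)
  qed simp
  have "cinner (h - p) y = 0" if y: "y \<in> M" for y
  proof (rule complex_eqI)
    show "Re (cinner (h - p) y) = Re 0" using re[OF y] by (simp add: inner_eq_Re_cinner)
    have "Re (cinner (h - p) (\<i> *\<^sub>C y)) = 0"
      using re[OF Msc[OF y]] by (simp add: inner_eq_Re_cinner)
    then show "Im (cinner (h - p) y) = Im 0" by (simp add: cinner_scaleC_right)
  qed
  then show ?thesis using pM by blast
qed

lemma oproj_eqI:
  assumes "csubspace M" "m \<in> M" "\<And>y. y \<in> M \<Longrightarrow> cinner (x - m) y = 0"
  shows "oproj M x = m"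
  unfolding oproj_def
proof (rule the_equality)
  fix k assume k: "k \<in> M \<and> (\<forall>y\<in>M. cinner (x - k) y = 0)"
  have mk: "k - m \<in> M" using csubspace_diff[OF assms(1)] k assms(2) by blast
  have "cinner (x - m) (k - m) - cinner (x - k) (k - m) = 0"
    using k mk assms(3) by simp
  then have "cinner (k - m) (k - m) = 0" by (simp flip: cinner_diff_left)
  then show "k = m" by simp
qed (use assms in auto)

lemma oproj:
  fixes x :: "'a::chilbert_space"
  assumes "closed_csubspace M"
  shows "oproj M x \<in> M" "y \<in> M \<Longrightarrow> cinner (x - oproj M x) y = 0"
proof -
  obtain m where m: "m \<in> M" "\<forall>y\<in>M. cinner (x - m) y = 0"
    using ortho_decomposition[OF assms] by blast
  have "oproj M x = m"
    using m assms by (intro oproj_eqI) (auto simp: closed_csubspace_def)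
  then show "oproj M x \<in> M" "y \<in> M \<Longrightarrow> cinner (x - oproj M x) y = 0" using m by auto
qed

lemma cadj_eqI:
  assumes "csubspace S" "x \<in> S" "\<And>s. s \<in> S \<Longrightarrow> cinner (F s) y = cinner s x"
  shows "cadj S F y = x"
  unfolding cadj_def
proof (rule the_equality)
  fix k assume k: "k \<in> S \<and> (\<forall>s\<in>S. cinner (F s) y = cinner s k)"
  have "k - x \<in> S" using csubspace_diff[OF assms(1)] k assms(2) by blast
  then have "cinner (k - x) k = cinner (k - x) x" using k assms(3) by metis
  then have "cinner (k - x) (k - x) = 0" by (simp add: cinner_diff_right)
  then show "k = x" by simp
qed (use assms in auto)

lemma cadj_exists:
  fixes F :: "'a::chilbert_space \<Rightarrow> 'b::complex_inner"
  assumes S: "closed_csubspace S" and F: "clinear_on S F"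
    and B: "\<And>s. s \<in> S \<Longrightarrow> norm (F s) \<le> B * norm s"
  shows "\<exists>x\<in>S. \<forall>s\<in>S. cinner (F s) y = cinner s x"
proof -
  have sub: "csubspace S" and clS: "closed S" using S by (auto simp: closed_csubspace_def)
  have S0: "0 \<in> S" and Sadd: "\<And>x y. x \<in> S \<Longrightarrow> y \<in> S \<Longrightarrow> x + y \<in> S"
    and Ssc: "\<And>c x. x \<in> S \<Longrightarrow> c *\<^sub>C x \<in> S"
    using sub by (auto simp: csubspace_def)
  define f where "f s = cinner (F s) y" for s
  have fadd: "f (s + t) = f s + f t" if "s \<in> S" "t \<in> S" for s t
    using F that by (simp add: f_def clinear_on_def cinner_add_left)
  have fsc: "f (c *\<^sub>C s) = c * f s" if "s \<in> S" for c s
    using F that by (simp add: f_def clinear_on_def cinner_scaleC_left)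
  have fdiff: "f (s - t) = f s - f t" if "s \<in> S" "t \<in> S" for s t
    using fadd[of "s - t" t] csubspace_diff[OF sub that] that by simp
  have fb: "cmod (f s) \<le> (B * norm y) * norm s" if "s \<in> S" for s
  proof -
    have "cmod (f s) \<le> norm (F s) * norm y" unfolding f_def by (rule cmod_cinner_le)
    also have "\<dots> \<le> (B * norm s) * norm y" by (intro mult_right_mono B that) simp
    finally show ?thesis by (simp add: mult_ac)
  qed
  define N where "N = {s \<in> S. f s = 0}"
  have f0: "f 0 = 0" using fsc[OF S0, of 0] by simp
  have "closed N"
  proof (rule closed_sequential_limits[THEN iffD2], intro allI impI)
    fix u l assume u: "(\<forall>n. u n \<in> N) \<and> u \<longlonglongrightarrow> l"
    have lS: "l \<in> S" using u clS by (metis (no_types, lifting) N_def closed_sequentially mem_Collect_eq)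
    have "(\<lambda>n. (B * norm y) * norm (l - u n)) \<longlonglongrightarrow> (B * norm y) * norm (l - l)"
      using u by (intro tendsto_intros) auto
    moreover have "cmod (f l) \<le> (B * norm y) * norm (l - u n)" for n
    proof -
      have "u n \<in> S" "f (u n) = 0" using u by (auto simp: N_def)
      then show ?thesis using fb[of "l - u n"] fdiff[of l "u n"] csubspace_diff[OF sub lS] lS by simp
    qed
    ultimately have "cmod (f l) \<le> (B * norm y) * norm (l - l)"
      by (intro LIMSEQ_le_const) auto
    then show "l \<in> N" using lS by (simp add: N_def)
  qed
  then have N: "closed_csubspace N"
    unfolding closed_csubspace_def csubspace_def N_def
    using S0 Sadd Ssc f0 fadd fsc by auto
  show ?thesis
  proof (cases "N = S")
    case True
    then show ?thesis using S0 by (intro bexI[of _ 0]) (auto simp: N_def f_def)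
  next
    case False
    then obtain t where t: "t \<in> S" "f t \<noteq> 0" by (auto simp: N_def)
    define z where "z = t - oproj N t"
    have pN: "oproj N t \<in> N" and zp: "\<And>v. v \<in> N \<Longrightarrow> cinner z v = 0"
      unfolding z_def using oproj[OF N] by auto
    have zS: "z \<in> S" and fz: "f z \<noteq> 0"
      using pN t csubspace_diff[OF sub] fdiff by (auto simp: N_def z_def)
    have z0: "z \<noteq> 0" using fz f0 by auto
    let ?x = "(cnj (f z) / complex_of_real ((norm z)\<^sup>2)) *\<^sub>C z"
    have "f s = cinner s ?x" if s: "s \<in> S" for s
    proof -
      have "s - (f s / f z) *\<^sub>C z \<in> N"
        using s zS fz csubspace_diff[OF sub s Ssc[OF zS]] fdiff[OF s Ssc[OF zS]] fsc[OF zS]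
        by (simp add: N_def)
      from zp[OF this] have "cinner (s - (f s / f z) *\<^sub>C z) z = 0"
        by (metis cinner_commute complex_cnj_zero)
      then have "cinner s z = (f s / f z) * complex_of_real ((norm z)\<^sup>2)"
        by (simp add: cinner_diff_left cinner_scaleC_left cinner_self)
      then show ?thesis using fz z0 by (simp add: cinner_scaleC_right)
    qed
    then show ?thesis using Ssc[OF zS] by (intro bexI[of _ ?x]) (auto simp: f_def)
  qed
qed

lemma cadj:
  fixes F :: "'a::chilbert_space \<Rightarrow> 'b::complex_inner"
  assumes "closed_csubspace S" "clinear_on S F" "\<And>s. s \<in> S \<Longrightarrow> norm (F s) \<le> B * norm s"
  shows "cadj S F y \<in> S" "s \<in> S \<Longrightarrow> cinner (F s) y = cinner s (cadj S F y)"
proof -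
  obtain x where x: "x \<in> S" "\<forall>s\<in>S. cinner (F s) y = cinner s x"
    using cadj_exists[OF assms] by blast
  have "cadj S F y = x"
    using x assms(1) by (intro cadj_eqI) (auto simp: closed_csubspace_def)
  then show "cadj S F y \<in> S" "s \<in> S \<Longrightarrow> cinner (F s) y = cinner s (cadj S F y)" using x by auto
qed

lemma isometric_on_norm:
  assumes "isometric_on S F" "s \<in> S"
  shows "norm (F s) = norm s"
proof -
  have "cinner (F s) (F s) = cinner s s" using assms by (simp add: isometric_on_def)
  then have "(norm (F s))\<^sup>2 = (norm s)\<^sup>2" by (simp only: cinner_self of_real_eq_iff)
  then show ?thesis by simp
qed

lemma cadj_isometric:
  fixes F :: "'a::chilbert_space \<Rightarrow> 'b::complex_inner"
  assumes S: "closed_csubspace S" and F: "isometric_on S F"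
  shows "cadj S F y \<in> S" "s \<in> S \<Longrightarrow> cinner (F s) y = cinner s (cadj S F y)"
proof -
  have lin: "clinear_on S F" using F by (simp add: isometric_on_def)
  have bd: "norm (F s) \<le> 1 * norm s" if "s \<in> S" for s
    using isometric_on_norm[OF F that] by simp
  show "cadj S F y \<in> S" by (rule cadj(1)[OF S lin bd])
  show "s \<in> S \<Longrightarrow> cinner (F s) y = cinner s (cadj S F y)" by (rule cadj(2)[OF S lin bd])
qed

lemma cadj_isometric_add:
  fixes F :: "'a::chilbert_space \<Rightarrow> 'b::complex_inner"
  assumes S: "closed_csubspace S" and F: "isometric_on S F"
  shows "cadj S F (y + z) = cadj S F y + cadj S F z"
proof (rule cadj_eqI)
  show sub: "csubspace S" using S by (simp add: closed_csubspace_def)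
  show "cadj S F y + cadj S F z \<in> S"
    using sub cadj_isometric(1)[OF S F] by (simp add: csubspace_def)
  fix s assume "s \<in> S"
  then show "cinner (F s) (y + z) = cinner s (cadj S F y + cadj S F z)"
    by (simp only: cinner_add_right cadj_isometric(2)[OF S F])
qed

lemma oproj_add:
  fixes x :: "'a::chilbert_space"
  assumes "closed_csubspace M"
  shows "oproj M (x + y) = oproj M x + oproj M y"
proof (rule oproj_eqI)
  fix v assume "v \<in> M"
  then have "cinner (x - oproj M x) v + cinner (y - oproj M y) v = 0"
    using oproj(2)[OF assms] by simp
  then show "cinner (x + y - (oproj M x + oproj M y)) v = 0"
    by (simp add: cinner_add_left cinner_diff_left algebra_simps)
qed (use assms oproj(1)[OF assms] in \<open>auto simp: closed_csubspace_def csubspace_def\<close>)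


section \<open>The Lifting Problem and its universal unitary colligation\<close>

text \<open>
  Throughout, a subspace of a Hilbert space means a closed subspace.

  The types \<open>'a\<close>, \<open>'b\<close> are the spaces \<open>\<K>'\<close>, \<open>\<K>''\<close>. The completion
  \<open>\<H>\<^sub>0\<close> and the copies \<open>\<Delta>~\<close>, \<open>\<Delta>~\<^sub>*\<close> of the
  defect spaces depend on the data, so they are not types: they are closed subspaces of the
  otherwise arbitrary Hilbert spaces \<open>'h\<close>, \<open>'d\<close>, \<open>'e\<close>.
\<close>

record ('a, 'b, 'h, 'd, 'e) lifting_data =
  U1 :: "'a \<Rightarrow> 'a"                \<comment> \<open>\<open>\<U>'\<close> on \<open>\<K>'\<close>\<close>
  U2 :: "'b \<Rightarrow> 'b"                \<comment> \<open>\<open>\<U>''\<close> on \<open>\<K>''\<close>\<close>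
  Kplus :: "'a set"            \<comment> \<open>\<open>\<K>'\<^sub>+\<close>\<close>
  Kminus :: "'b set"           \<comment> \<open>\<open>\<K>''\<^sub>-\<close>\<close>
  Xop :: "'a \<Rightarrow> 'b"               \<comment> \<open>the contraction \<open>X\<close>, relevant on \<open>\<K>'\<^sub>+\<close>\<close>
  G1 :: "'a set"               \<comment> \<open>\<open>\<G>'\<close>\<close>
  G2 :: "'b set"               \<comment> \<open>\<open>\<G>''\<close>\<close>
  emb :: "'b \<times> 'a \<Rightarrow> 'h"          \<comment> \<open>\<open>(k''\<^sub>-, k'\<^sub>+) \<mapsto> [k''\<^sub>-, k'\<^sub>+]\<close>, from pairs to their classes in \<open>\<H>\<^sub>0\<close>\<close>
  Del :: "'d set"              \<comment> \<open>\<open>\<Delta>~\<close>\<close>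
  iDel :: "'d \<Rightarrow> 'h"              \<comment> \<open>\<open>\<Delta>~ \<rightarrow> \<Delta>\<close>\<close>
  Dels :: "'e set"             \<comment> \<open>\<open>\<Delta>~\<^sub>*\<close>\<close>
  iDels :: "'e \<Rightarrow> 'h"             \<comment> \<open>\<open>\<Delta>~\<^sub>* \<rightarrow> \<Delta>\<^sub>*\<close>\<close>

definition lifting_problem ::
  "('a::chilbert_space, 'b::chilbert_space, 'h, 'd, 'e) lifting_data \<Rightarrow> bool" where
  "lifting_problem L \<longleftrightarrow>
     unitary (U1 L) \<and> unitary (U2 L) \<and>
     closed_csubspace (Kplus L) \<and> closed_csubspace (Kminus L) \<and>
     star_cyclic (U1 L) (Kplus L) \<and> star_cyclic (U2 L) (Kminus L) \<and>
     U1 L ` Kplus L \<subseteq> Kplus L \<and> cadj UNIV (U2 L) ` Kminus L \<subseteq> Kminus L \<and>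
     clinear_on (Kplus L) (Xop L) \<and> Xop L ` Kplus L \<subseteq> Kminus L \<and>
     (\<forall>k\<in>Kplus L. norm (Xop L k) \<le> norm k) \<and>
     (\<forall>k\<in>Kplus L. Xop L (U1 L k) = oproj (Kminus L) (U2 L (Xop L k)))"

definition coefficient_spaces ::
  "('a::chilbert_space, 'b::chilbert_space, 'h, 'd, 'e) lifting_data \<Rightarrow> bool" where
  "coefficient_spaces L \<longleftrightarrow>
     closed_csubspace (G1 L) \<and> G1 L \<subseteq> Kplus L \<and> star_cyclic (U1 L) (G1 L) \<and>
     closed_csubspace (G2 L) \<and> G2 L \<subseteq> Kminus L \<and> star_cyclic (U2 L) (G2 L)"

text \<open>The operator matrix with rows \<open>[I, X]\<close> and \<open>[X*, I]\<close>.\<close>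

definition gram ::
  "('a::chilbert_space, 'b::chilbert_space, 'h, 'd, 'e) lifting_data \<Rightarrow> 'b \<times> 'a \<Rightarrow> 'b \<times> 'a" where
  "gram L = (\<lambda>(k2, k1). (k2 + Xop L k1, cadj (Kplus L) (Xop L) k2 + k1))"

text \<open>
  \<open>emb\<close> is a linear map that carries the semi-inner product given by \<open>gram\<close> to the inner product
  of a Hilbert space; the closure \<open>H0\<close> of its range is then the Hilbert space completion of the
  space of pairs modulo the pairs of zero norm. Completions are unique up to a unitary
  equivalence compatible with \<open>emb\<close>.
\<close>

definition completion_embedding ::
  "('a::chilbert_space, 'b::chilbert_space, 'h::chilbert_space, 'd, 'e) lifting_data \<Rightarrow> bool" where
  "completion_embedding L \<longleftrightarrow>
     clinear_on (Kminus L \<times> Kplus L) (emb L) \<and>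
     (\<forall>p\<in>Kminus L \<times> Kplus L. \<forall>q\<in>Kminus L \<times> Kplus L.
        cinner (emb L p) (emb L q) = cinner (gram L p) q)"

definition H0 :: "('a, 'b, 'h::chilbert_space, 'd, 'e) lifting_data \<Rightarrow> 'h set" where
  "H0 L = closure (emb L ` (Kminus L \<times> Kplus L))"

definition Dom :: "('a, 'b, 'h::chilbert_space, 'd, 'e) lifting_data \<Rightarrow> 'h set" where
  "Dom L = closure (emb L ` (Kminus L \<times> U1 L ` Kplus L))"

definition Doms ::
  "('a, 'b::chilbert_space, 'h::chilbert_space, 'd, 'e) lifting_data \<Rightarrow> 'h set" where
  "Doms L = closure (emb L ` (cadj UNIV (U2 L) ` Kminus L \<times> Kplus L))"

definition defect :: "('a, 'b, 'h::chilbert_space, 'd, 'e) lifting_data \<Rightarrow> 'h set" where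
  "defect L = {h \<in> H0 L. \<forall>d\<in>Dom L. cinner h d = 0}"

definition defects ::
  "('a, 'b::chilbert_space, 'h::chilbert_space, 'd, 'e) lifting_data \<Rightarrow> 'h set" where
  "defects L = {h \<in> H0 L. \<forall>d\<in>Doms L. cinner h d = 0}"

definition defect_copies ::
  "('a, 'b::chilbert_space, 'h::chilbert_space, 'd::chilbert_space, 'e::chilbert_space) lifting_data
     \<Rightarrow> bool" where
  "defect_copies L \<longleftrightarrow>
     closed_csubspace (Del L) \<and> isometric_on (Del L) (iDel L) \<and> iDel L ` Del L = defect L \<and>
     closed_csubspace (Dels L) \<and> isometric_on (Dels L) (iDels L) \<and> iDels L ` Dels L = defects L"

text \<open>
  \<open>V\<close> is the isometric map \<open>[k''\<^sub>-, \<U>' k'\<^sub>+] \<mapsto> [\<U>''* k''\<^sub>-, k'\<^sub>+]\<close> extended by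
  continuity to \<open>Dom\<close>, i.e. the map whose graph is the closure of the graph of the former.
\<close>

definition Vop ::
  "('a::chilbert_space, 'b::chilbert_space, 'h::chilbert_space, 'd, 'e) lifting_data \<Rightarrow> 'h \<Rightarrow> 'h"
  where
  "Vop L d = (THE w. (d, w) \<in> closure
     {(emb L (k2, U1 L k1), emb L (cadj UNIV (U2 L) k2, k1)) | k2 k1.
        k2 \<in> Kminus L \<and> k1 \<in> Kplus L})"

definition A0 ::
  "('a::chilbert_space, 'b::chilbert_space, 'h::chilbert_space, 'd, 'e) lifting_data \<Rightarrow> 'h \<Rightarrow> 'h"
  where
  "A0 L h = Vop L (oproj (Dom L) h)"

definition B0 :: "('a, 'b, 'h, 'd, 'e) lifting_data \<Rightarrow> 'e \<Rightarrow> 'h" where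
  "B0 L = iDels L"

definition C0 ::
  "('a, 'b, 'h::chilbert_space, 'd::chilbert_space, 'e) lifting_data \<Rightarrow> 'h \<Rightarrow> 'd" where
  "C0 L h = cadj (Del L) (iDel L) (h - oproj (Dom L) h)"

definition iG1 :: "('a, 'b::chilbert_space, 'h, 'd, 'e) lifting_data \<Rightarrow> 'a \<Rightarrow> 'h" where
  "iG1 L g = emb L (0, g)"

definition iG2 :: "('a::chilbert_space, 'b, 'h, 'd, 'e) lifting_data \<Rightarrow> 'b \<Rightarrow> 'h" where
  "iG2 L g = emb L (g, 0)"


section \<open>The Redheffer coefficient-matrix symbol\<close>

definition redh_s0 ::
  "('a::chilbert_space, 'b::chilbert_space, 'h::chilbert_space, 'd, 'e) lifting_data
     \<Rightarrow> int \<Rightarrow> 'a \<Rightarrow> 'b" where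
  "redh_s0 L n g =
     (if n \<ge> 0 then cadj (G2 L) (iG2 L) ((A0 L ^^ nat n) (iG1 L g))
      else cadj (G2 L) (iG2 L) ((cadj (H0 L) (A0 L) ^^ nat \<bar>n\<bar>) (iG1 L g)))"

definition redh_s1 ::
  "('a::chilbert_space, 'b::chilbert_space, 'h::chilbert_space, 'd::chilbert_space, 'e) lifting_data
     \<Rightarrow> int \<Rightarrow> 'a \<Rightarrow> 'd" where
  "redh_s1 L n g = (if n \<ge> 0 then C0 L ((A0 L ^^ nat n) (iG1 L g)) else 0)"

definition redh_s2 ::
  "('a::chilbert_space, 'b::chilbert_space, 'h::chilbert_space, 'd, 'e) lifting_data
     \<Rightarrow> int \<Rightarrow> 'e \<Rightarrow> 'b" where
  "redh_s2 L n e = (if n \<ge> 1 then cadj (G2 L) (iG2 L) ((A0 L ^^ nat (n - 1)) (B0 L e)) else 0)"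

definition redh_s ::
  "('a::chilbert_space, 'b::chilbert_space, 'h::chilbert_space, 'd::chilbert_space, 'e) lifting_data
     \<Rightarrow> int \<Rightarrow> 'e \<Rightarrow> 'd" where
  "redh_s L n e = (if n \<ge> 1 then C0 L ((A0 L ^^ nat (n - 1)) (B0 L e)) else 0)"

text \<open>
  \<open>redh_s2\<close> and \<open>redh_s\<close> generate the Toeplitz matrices of the input-to-output maps below, which send
  sequences indexed by the nonnegative integers to sequences indexed by all integers.
\<close>

definition generates_toeplitz ::
  "(int \<Rightarrow> 'e \<Rightarrow> 'x) \<Rightarrow> ((nat \<Rightarrow> 'e) \<Rightarrow> int \<Rightarrow> 'x::{comm_monoid_add, topological_space}) \<Rightarrow> bool" where
  "generates_toeplitz t T \<longleftrightarrow> (\<forall>d n. ((\<lambda>k. t (n - int k) (d k)) has_sum T d n) UNIV)"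

definition output_map2 ::
  "('a::chilbert_space, 'b::chilbert_space, 'h::chilbert_space, 'd, 'e) lifting_data
     \<Rightarrow> (nat \<Rightarrow> 'e) \<Rightarrow> int \<Rightarrow> 'b" where
  "output_map2 L d n =
     (if n \<ge> 0
      then cadj (G2 L) (iG2 L) (\<Sum>k<nat n. (A0 L ^^ (nat n - 1 - k)) (B0 L (d k)))
      else 0)"

definition output_map ::
  "('a::chilbert_space, 'b::chilbert_space, 'h::chilbert_space, 'd::chilbert_space, 'e) lifting_data
     \<Rightarrow> (nat \<Rightarrow> 'e) \<Rightarrow> int \<Rightarrow> 'd" where
  "output_map L d n =
     (if n \<ge> 0 then \<Sum>k<nat n. C0 L ((A0 L ^^ (nat n - 1 - k)) (B0 L (d k))) else 0)"

lemma generates_toeplitz_aux: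
  assumes "\<And>k. k < nat n \<Longrightarrow> t (n - int k) (d k) = F k"
    and "\<And>k. k \<ge> nat n \<Longrightarrow> t (n - int k) (d k) = 0"
  shows "((\<lambda>k. t (n - int k) (d k)) has_sum (\<Sum>k<nat n. F k)) UNIV"
  by (rule has_sum_finite_neutralI[of "{..<nat n}"]) (use assms in \<open>auto simp: not_less\<close>)

lemma redh_s_generates_toeplitz: "generates_toeplitz (redh_s L) (output_map L)"
  unfolding generates_toeplitz_def
proof (intro allI)
  fix d and n :: int
  have "((\<lambda>k. redh_s L (n - int k) (d k)) has_sum
      (\<Sum>k<nat n. C0 L ((A0 L ^^ (nat n - 1 - k)) (B0 L (d k))))) UNIV"
    by (rule generates_toeplitz_aux)
      (auto simp: redh_s_def nat_diff_distrib intro!: arg_cong[of _ _ "\<lambda>k. C0 L ((A0 L ^^ k) _)"])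
  then show "((\<lambda>k. redh_s L (n - int k) (d k)) has_sum output_map L d n) UNIV"
    by (cases "n \<ge> 0") (simp_all add: output_map_def)
qed

lemma iG2_isometric:
  assumes "lifting_problem L" "coefficient_spaces L" "completion_embedding L"
  shows "isometric_on (G2 L) (iG2 L)"
proof -
  have sub: "csubspace (Kplus L)" and G: "G2 L \<subseteq> Kminus L"
    and X: "clinear_on (Kplus L) (Xop L)"
    using assms by (auto simp: lifting_problem_def coefficient_spaces_def closed_csubspace_def)
  have K0: "0 \<in> Kplus L" using sub by (simp add: csubspace_def)
  have X0: "Xop L 0 = 0"
    using X K0 unfolding clinear_on_def by (metis scaleC_zero_left)
  have P: "(g, 0) \<in> Kminus L \<times> Kplus L" if "g \<in> G2 L" for g using that G K0 by auto
  have lin: "clinear_on (Kminus L \<times> Kplus L) (emb L)"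
    and form: "\<And>p q. p \<in> Kminus L \<times> Kplus L \<Longrightarrow> q \<in> Kminus L \<times> Kplus L \<Longrightarrow>
        cinner (emb L p) (emb L q) = cinner (gram L p) q"
    using assms(3) by (auto simp: completion_embedding_def)
  show ?thesis
    unfolding isometric_on_def clinear_on_def
  proof (intro conjI ballI allI)
    fix x y assume xy: "x \<in> G2 L" "y \<in> G2 L"
    show "cinner (iG2 L x) (iG2 L y) = cinner x y"
      by (simp add: iG2_def form[OF P[OF xy(1)] P[OF xy(2)]] gram_def cinner_prod_def X0)
    have "emb L ((x, 0) + (y, 0)) = emb L (x, 0) + emb L (y, 0)"
      using lin P[OF xy(1)] P[OF xy(2)] unfolding clinear_on_def by blast
    then show "iG2 L (x + y) = iG2 L x + iG2 L y" by (simp add: iG2_def)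
  next
    fix c x assume x: "x \<in> G2 L"
    have "emb L (c *\<^sub>C (x, 0)) = c *\<^sub>C emb L (x, 0)"
      using lin P[OF x] unfolding clinear_on_def by blast
    then show "iG2 L (c *\<^sub>C x) = c *\<^sub>C iG2 L x" by (simp add: iG2_def scaleC_prod_def)
  qed
qed

lemma redh_s2_generates_toeplitz:
  assumes "lifting_problem L" "coefficient_spaces L" "completion_embedding L"
  shows "generates_toeplitz (redh_s2 L) (output_map2 L)"
  unfolding generates_toeplitz_def
proof (intro allI)
  fix d and n :: int
  let ?i = "cadj (G2 L) (iG2 L)"
  have G: "closed_csubspace (G2 L)" using assms(2) by (simp add: coefficient_spaces_def)
  have add: "?i (x + y) = ?i x + ?i y" for x y
    by (rule cadj_isometric_add[OF G iG2_isometric[OF assms]])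
  have zero: "?i 0 = 0" using add[of 0 0] by simp
  have sum: "?i (\<Sum>k<m. f k) = (\<Sum>k<m. ?i (f k))" for f and m :: nat
    by (induction m) (simp_all add: add zero)
  have "((\<lambda>k. redh_s2 L (n - int k) (d k)) has_sum
      (\<Sum>k<nat n. ?i ((A0 L ^^ (nat n - 1 - k)) (B0 L (d k))))) UNIV"
    by (rule generates_toeplitz_aux)
      (auto simp: redh_s2_def nat_diff_distrib intro!: arg_cong[of _ _ "\<lambda>k. ?i ((A0 L ^^ k) _)"])
  then show "((\<lambda>k. redh_s2 L (n - int k) (d k)) has_sum output_map2 L d n) UNIV"
    by (cases "n \<ge> 0") (simp_all add: output_map2_def sum)
qed


section \<open>The universal extension\<close>

text \<open>
  \<open>K0\<close> is the direct sum of \<open>\<H>\<^sub>0\<close>, the square-summable \<open>\<Delta>~\<close>-valued sequences on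
  the negative integers and the square-summable \<open>\<Delta>~\<^sub>*\<close>-valued sequences on the
  nonnegative integers; sequences are extended by zero to all integers.
\<close>

definition K0 ::
  "('a, 'b, 'h::chilbert_space, 'd::chilbert_space, 'e::chilbert_space) lifting_data
     \<Rightarrow> ('h \<times> 'd ell2 \<times> 'e ell2) set" where
  "K0 L = {(h, x, y). h \<in> H0 L \<and>
     (\<forall>n. coord x n \<in> Del L) \<and> (\<forall>n\<ge>0. coord x n = 0) \<and>
     (\<forall>n. coord y n \<in> Dels L) \<and> (\<forall>n<0. coord y n = 0)}"

definition U0adj ::
  "('a::chilbert_space, 'b::chilbert_space, 'h::chilbert_space, 'd::chilbert_space,
    'e::chilbert_space) lifting_data \<Rightarrow> 'h \<times> 'd ell2 \<times> 'e ell2 \<Rightarrow> 'h \<times> 'd ell2 \<times> 'e ell2" where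
  "U0adj L = (\<lambda>(h, x, y).
     (A0 L h + iDels L (cadj (Dels L) (ell2_single 0) y),
      ell2_single (-1) (cadj (Del L) (iDel L) h) + Jminus_adj x,
      Jplus_adj y))"

definition U0 ::
  "('a::chilbert_space, 'b::chilbert_space, 'h::chilbert_space, 'd::chilbert_space,
    'e::chilbert_space) lifting_data \<Rightarrow> 'h \<times> 'd ell2 \<times> 'e ell2 \<Rightarrow> 'h \<times> 'd ell2 \<times> 'e ell2" where
  "U0 L = cadj (K0 L) (U0adj L)"

text \<open>Integer powers of \<open>U0adj\<close>; the inverse of the unitary operator \<open>U0adj\<close> on \<open>K0\<close> is \<open>U0\<close>.\<close>

definition U0adj_pow ::
  "('a::chilbert_space, 'b::chilbert_space, 'h::chilbert_space, 'd::chilbert_space,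
    'e::chilbert_space) lifting_data
     \<Rightarrow> int \<Rightarrow> 'h \<times> 'd ell2 \<times> 'e ell2 \<Rightarrow> 'h \<times> 'd ell2 \<times> 'e ell2" where
  "U0adj_pow L n = (if n \<ge> 0 then U0adj L ^^ nat n else U0 L ^^ nat \<bar>n\<bar>)"

definition iG1_0 ::
  "('a::chilbert_space, 'b::chilbert_space, 'h::chilbert_space, 'd::chilbert_space,
    'e::chilbert_space) lifting_data \<Rightarrow> 'a \<Rightarrow> 'h \<times> 'd ell2 \<times> 'e ell2" where
  "iG1_0 L g = (iG1 L g, 0, 0)"

definition iG2_0 ::
  "('a::chilbert_space, 'b::chilbert_space, 'h::chilbert_space, 'd::chilbert_space,
    'e::chilbert_space) lifting_data \<Rightarrow> 'b \<Rightarrow> 'h \<times> 'd ell2 \<times> 'e ell2" where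
  "iG2_0 L g = (iG2 L g, 0, 0)"

definition iDel_0 ::
  "('a, 'b, 'h::chilbert_space, 'd::chilbert_space, 'e::chilbert_space) lifting_data
     \<Rightarrow> 'd \<Rightarrow> 'h \<times> 'd ell2 \<times> 'e ell2" where
  "iDel_0 L x = (0, ell2_single (-1) x, 0)"

definition iDels_0 ::
  "('a, 'b, 'h::chilbert_space, 'd::chilbert_space, 'e::chilbert_space) lifting_data
     \<Rightarrow> 'e \<Rightarrow> 'h \<times> 'd ell2 \<times> 'e ell2" where
  "iDels_0 L y = (0, 0, ell2_single 0 y)"

end

theory Submission
  imports Defs
begin

text \<open>
  In block form \<open>U0\<close> maps \<open>(h, 0, y)\<close> to \<open>(A\<^sub>0* h, 0, y')\<close>, so the powers of \<open>U0\<close> never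
  leave \<open>\<H>\<^sub>0 \<oplus> 0 \<oplus> \<ell>\<^sup>2(\<Delta>~\<^sub>*)\<close>, while those of \<open>U0adj\<close> never leave
  \<open>\<H>\<^sub>0 \<oplus> \<ell>\<^sup>2(\<Delta>~) \<oplus> 0\<close>; on either subspace the first component is governed by \<open>A\<^sub>0*\<close>
  or \<open>A\<^sub>0\<close> alone. The zeros of \<open>s\<^sub>1\<close> at negative indices come from \<open>A\<^sub>0\<close> vanishing on \<open>\<Delta>\<close>:
  the range of \<open>A\<^sub>0*\<close> is orthogonal to \<open>\<Delta>\<close>.
\<close>

section \<open>Subspaces and isometric graphs\<close>

lemma closed_csubspace_UNIV: "closed_csubspace UNIV"
  by (simp add: closed_csubspace_def csubspace_def)

lemma csubspace_Times: "csubspace A \<Longrightarrow> csubspace B \<Longrightarrow> csubspace (A \<times> B)"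
  by (auto simp: csubspace_def scaleC_prod_def zero_prod_def)

lemma clinear_on_subset: "clinear_on S f \<Longrightarrow> T \<subseteq> S \<Longrightarrow> clinear_on T f"
  unfolding clinear_on_def by blast

lemma clinear_on_zero: "clinear_on S f \<Longrightarrow> 0 \<in> S \<Longrightarrow> f 0 = 0"
  unfolding clinear_on_def by (metis scaleC_zero_left)

lemma csubspace_image:
  assumes "csubspace S" "clinear_on S f"
  shows "csubspace (f ` S)"
  unfolding csubspace_def
proof (intro conjI ballI allI)
  show "0 \<in> f ` S"
    using assms clinear_on_zero[OF assms(2)] by (auto simp: csubspace_def image_iff)
next
  fix x y assume "x \<in> f ` S" "y \<in> f ` S"
  then obtain a b where ab: "a \<in> S" "b \<in> S" "x = f a" "y = f b" by blast
  then have "f (a + b) = x + y" using assms(2) by (simp add: clinear_on_def)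
  moreover have "a + b \<in> S" using assms(1) ab by (simp add: csubspace_def)
  ultimately show "x + y \<in> f ` S" by (metis imageI)
next
  fix c x assume "x \<in> f ` S"
  then obtain a where a: "a \<in> S" "x = f a" by blast
  then have "f (c *\<^sub>C a) = c *\<^sub>C x" using assms(2) by (simp add: clinear_on_def)
  moreover have "c *\<^sub>C a \<in> S" using assms(1) a by (simp add: csubspace_def)
  ultimately show "c *\<^sub>C x \<in> f ` S" by (metis imageI)
qed

lemma tendsto_scaleC:
  assumes "(f \<longlongrightarrow> l) F"
  shows "((\<lambda>n. c *\<^sub>C f n) \<longlongrightarrow> c *\<^sub>C (l::'a::complex_inner)) F"
proof -
  have "((\<lambda>n. cmod c * norm (f n - l)) \<longlongrightarrow> 0) F"
    using assms by (intro tendsto_mult_right_zero tendsto_norm_zero LIM_zero)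
  then have "((\<lambda>n. norm (c *\<^sub>C f n - c *\<^sub>C l)) \<longlongrightarrow> 0) F"
    by (simp add: norm_scaleC flip: scaleC_diff_right)
  then show ?thesis using LIM_zero_cancel tendsto_norm_zero_iff by blast
qed

lemma closed_csubspace_closure:
  assumes "csubspace S"
  shows "closed_csubspace (closure S)"
  unfolding closed_csubspace_def csubspace_def
proof (intro conjI ballI allI)
  show "0 \<in> closure S" using assms closure_subset by (auto simp: csubspace_def)
next
  fix x y assume "x \<in> closure S" "y \<in> closure S"
  then obtain u v where uv: "\<And>n. u n \<in> S" "u \<longlonglongrightarrow> x" "\<And>n. v n \<in> S" "v \<longlonglongrightarrow> y"
    unfolding closure_sequential by blast
  have "\<forall>n. u n + v n \<in> S" using assms uv by (simp add: csubspace_def)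
  moreover have "(\<lambda>n. u n + v n) \<longlonglongrightarrow> x + y" using uv by (intro tendsto_add)
  ultimately show "x + y \<in> closure S"
    unfolding closure_sequential by (intro exI[of _ "\<lambda>n. u n + v n"]) simp
next
  fix c x assume "x \<in> closure S"
  then obtain u where u: "\<And>n. u n \<in> S" "u \<longlonglongrightarrow> x" unfolding closure_sequential by blast
  have "\<forall>n. c *\<^sub>C u n \<in> S" using assms u by (simp add: csubspace_def)
  moreover have "(\<lambda>n. c *\<^sub>C u n) \<longlonglongrightarrow> c *\<^sub>C x" using u by (intro tendsto_scaleC)
  ultimately show "c *\<^sub>C x \<in> closure S"
    unfolding closure_sequential by (intro exI[of _ "\<lambda>n. c *\<^sub>C u n"]) simp
qed simp

text \<open>Equality of norms is a closed condition, so it survives in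
  \<open>closure \<Gamma>\<close>; together with linearity this makes the closure single-valued.
  Completeness of the target space makes it defined on the whole closure of the domain. The definite
  description has the form used in \<open>Vop\<close>, so that the result applies to V.\<close>

lemma isometric_graph_closure:
  fixes \<Gamma> :: "('a::chilbert_space \<times> 'b::chilbert_space) set"
  assumes sub: "csubspace \<Gamma>" and iso: "\<And>u w. (u, w) \<in> \<Gamma> \<Longrightarrow> norm w = norm u"
  defines "f \<equiv> \<lambda>u. THE w. (u, w) \<in> closure \<Gamma>"
  shows "clinear_on (closure (fst ` \<Gamma>)) f"
    and "u \<in> closure (fst ` \<Gamma>) \<Longrightarrow> norm (f u) = norm u"
proof -
  let ?G = "closure \<Gamma>"
  have G: "csubspace ?G" using closed_csubspace_closure[OF sub] by (simp add: closed_csubspace_def)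
  have isoG: "norm w = norm u" if uw: "(u, w) \<in> ?G" for u w
  proof -
    have "closed {p :: 'a \<times> 'b. norm (snd p) = norm (fst p)}"
      by (intro closed_Collect_eq continuous_intros)
    moreover have "\<Gamma> \<subseteq> {p. norm (snd p) = norm (fst p)}" using iso by auto
    ultimately have "?G \<subseteq> {p. norm (snd p) = norm (fst p)}" by (rule closure_minimal[rotated])
    then show ?thesis using uw by auto
  qed
  \<comment> \<open>The difference of two such pairs is \<open>(0, w - w')\<close>, and equality of
    norms forces its second entry to vanish.\<close>
  have unique: "w = w'" if "(u, w) \<in> ?G" "(u, w') \<in> ?G" for u w w'
    using isoG[of 0 "w - w'"] csubspace_diff[OF G that] by simp
  have fI: "f u = w" if "(u, w) \<in> ?G" for u w
    unfolding f_def using that unique by (intro the_equality) auto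
  have total: "(u, f u) \<in> ?G" if u: "u \<in> closure (fst ` \<Gamma>)" for u
  proof -
    obtain v where v: "\<And>n. v n \<in> fst ` \<Gamma>" and vu: "v \<longlonglongrightarrow> u"
      using u unfolding closure_sequential by blast
    have "\<exists>w. (v n, w) \<in> \<Gamma>" for n using v[of n] by force
    then obtain w where w: "\<And>n. (v n, w n) \<in> \<Gamma>" by metis
    \<comment> \<open>Differences of graph points are again graph points, so the second coordinates
      inherit the Cauchy property of \<open>v\<close>.\<close>
    have "dist (w m) (w n) = dist (v m) (v n)" for m n
      using iso[of "v m - v n" "w m - w n"] csubspace_diff[OF sub w w] by (simp add: dist_norm)
    then have "Cauchy w"
      using LIMSEQ_imp_Cauchy[OF vu] by (simp add: Cauchy_def)
    then obtain l where "w \<longlonglongrightarrow> l" using Cauchy_convergent_iff convergent_def by blast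
    then have "(\<lambda>n. (v n, w n)) \<longlonglongrightarrow> (u, l)" using vu by (intro tendsto_Pair)
    then have "(u, l) \<in> ?G" unfolding closure_sequential using w by (intro exI[of _ "\<lambda>n. (v n, w n)"]) simp
    then show ?thesis using fI by simp
  qed
  show "clinear_on (closure (fst ` \<Gamma>)) f"
    unfolding clinear_on_def
  proof (intro conjI ballI allI)
    fix x y assume "x \<in> closure (fst ` \<Gamma>)" "y \<in> closure (fst ` \<Gamma>)"
    then have "(x, f x) + (y, f y) \<in> ?G" using total G unfolding csubspace_def by blast
    then show "f (x + y) = f x + f y" using fI by simp
  next
    fix c x assume "x \<in> closure (fst ` \<Gamma>)"
    then have "c *\<^sub>C (x, f x) \<in> ?G" using total G unfolding csubspace_def by blast
    then show "f (c *\<^sub>C x) = c *\<^sub>C f x" using fI by (simp add: scaleC_prod_def)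
  qed
  show "norm (f u) = norm u" if "u \<in> closure (fst ` \<Gamma>)"
    using isoG total that by blast
qed

section \<open>Homogeneity and bounds of adjoints and projections\<close>

lemma cadj_isometric_scaleC:
  fixes F :: "'a::chilbert_space \<Rightarrow> 'b::complex_inner"
  assumes S: "closed_csubspace S" and F: "isometric_on S F"
  shows "cadj S F (c *\<^sub>C y) = c *\<^sub>C cadj S F y"
proof (rule cadj_eqI)
  show sub: "csubspace S" using S by (simp add: closed_csubspace_def)
  show "c *\<^sub>C cadj S F y \<in> S"
    using sub cadj_isometric(1)[OF S F] by (simp add: csubspace_def)
  fix s assume "s \<in> S"
  then show "cinner (F s) (c *\<^sub>C y) = cinner s (c *\<^sub>C cadj S F y)"
    by (simp only: cinner_scaleC_right cadj_isometric(2)[OF S F])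
qed

lemma cadj_zero: "csubspace S \<Longrightarrow> cadj S F 0 = 0"
  by (rule cadj_eqI) (auto simp: csubspace_def)

lemma oproj_scaleC:
  fixes x :: "'a::chilbert_space"
  assumes "closed_csubspace M"
  shows "oproj M (c *\<^sub>C x) = c *\<^sub>C oproj M x"
proof (rule oproj_eqI)
  fix v assume "v \<in> M"
  then show "cinner (c *\<^sub>C x - c *\<^sub>C oproj M x) v = 0"
    using oproj(2)[OF assms] by (simp add: cinner_scaleC_left flip: scaleC_diff_right)
qed (use assms oproj(1)[OF assms] in \<open>auto simp: closed_csubspace_def csubspace_def\<close>)

lemma norm_oproj_le:
  fixes x :: "'a::chilbert_space"
  assumes "closed_csubspace M"
  shows "norm (oproj M x) \<le> norm x"
proof -
  have "cinner (x - oproj M x) (oproj M x) = 0" using oproj[OF assms] by blast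
  then have "inner (x - oproj M x) (oproj M x) = 0" by (simp add: inner_eq_Re_cinner)
  then have "(norm (oproj M x))\<^sup>2 = inner x (oproj M x)"
    by (simp add: power2_norm_eq_inner inner_diff_left)
  also have "\<dots> \<le> norm x * norm (oproj M x)" by (rule norm_cauchy_schwarz)
  finally show ?thesis
    by (cases "oproj M x = 0") (simp_all add: power2_eq_square)
qed


section \<open>Coordinates of square-summable sequences\<close>

lemma ell2_eqI: "(\<And>n. coord x n = coord y n) \<Longrightarrow> x = y"
  by (metis coord_inject ext)

lemma coord_zero [simp]: "coord 0 n = 0"
  by (simp add: zero_ell2.rep_eq)

lemma coord_single: "coord (ell2_single n x) m = (if m = n then x else 0)"
  by (simp add: ell2_single.rep_eq)

lemma ell2_single_zero [simp]: "ell2_single n 0 = 0"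
  by (rule ell2_eqI) (simp add: coord_single)

lemma Jminus_adj_zero [simp]: "Jminus_adj 0 = 0"
  by (rule ell2_eqI) (simp add: Jminus_adj.rep_eq)

lemma Jplus_adj_zero [simp]: "Jplus_adj 0 = 0"
  by (rule ell2_eqI) (simp add: Jplus_adj.rep_eq)

lemma Jplus_adj_single_0 [simp]: "Jplus_adj (ell2_single 0 x) = 0"
  by (rule ell2_eqI) (simp add: Jplus_adj.rep_eq coord_single)

lemma cinner_single_left: "cinner (ell2_single n v) x = cinner v (coord x n)"
proof -
  have "cinner (ell2_single n v) x = (\<Sum>\<^sub>\<infinity>m\<in>{n}. cinner (coord (ell2_single n v) m) (coord x m))"
    unfolding cinner_ell2_def by (rule infsum_cong_neutral) (auto simp: coord_single)
  then show ?thesis by (simp add: coord_single)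
qed

lemma cinner_single_right: "cinner x (ell2_single n v) = cinner (coord x n) v"
  by (metis cinner_commute cinner_single_left)

text \<open>An adjoint taken over \<open>S\<close> has its values in \<open>S\<close>, so the
  coordinate must lie there to qualify.\<close>

lemma cadj_single:
  "csubspace S \<Longrightarrow> coord y n \<in> S \<Longrightarrow> cadj S (ell2_single n) y = coord y n"
  by (rule cadj_eqI) (simp_all add: cinner_single_left)

text \<open>On sequences supported in the nonnegative indices this is the forward shift J_+, whose
  adjoint is \<open>Jplus_adj\<close>. It moves the whole two-sided sequence, so no cutoff is
  involved.\<close>

lift_definition ell2_rshift :: "'a::complex_inner ell2 \<Rightarrow> 'a ell2" is "\<lambda>f n. f (n - 1)"
proof -
  fix f :: "int \<Rightarrow> 'a" assume f: "(\<lambda>n. (norm (f n))\<^sup>2) summable_on UNIV"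
  have "bij (\<lambda>n::int. n - 1)" by (rule o_bij[of "\<lambda>n. n + 1"]) auto
  then show "(\<lambda>n. (norm (f (n - 1)))\<^sup>2) summable_on UNIV"
    using f by (subst summable_on_reindex_bij_betw[of "\<lambda>n. n - 1" UNIV UNIV]) auto
qed

text \<open>The support of \<open>y\<close> hides the cutoff in \<open>Jplus_adj\<close>: terms with
  negative index vanish on both sides. What remains is the reindexing by
  \<open>n + 1\<close>.\<close>

lemma cinner_Jplus_adj:
  assumes "\<And>n. n < 0 \<Longrightarrow> coord y n = 0"
  shows "cinner (Jplus_adj x) y = cinner x (ell2_rshift y)"
proof -
  have bij: "bij (\<lambda>n::int. n + 1)" by (rule o_bij[of "\<lambda>n. n - 1"]) auto
  have "cinner (Jplus_adj x) y = (\<Sum>\<^sub>\<infinity>n. cinner (coord x (n + 1)) (coord (ell2_rshift y) (n + 1)))"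
    unfolding cinner_ell2_def
    by (rule infsum_cong) (auto simp: Jplus_adj.rep_eq ell2_rshift.rep_eq assms)
  also have "\<dots> = cinner x (ell2_rshift y)"
    unfolding cinner_ell2_def
    by (rule infsum_reindex_bij_betw[OF bij, of "\<lambda>n. cinner (coord x n) (coord (ell2_rshift y) n)"])
  finally show ?thesis .
qed


section \<open>The colligation and the universal extension\<close>

locale lifting_model =
  fixes L :: "('a::chilbert_space, 'b::chilbert_space, 'h::chilbert_space,
               'd::chilbert_space, 'e::chilbert_space) lifting_data"
  assumes lifting: "lifting_problem L"
    and completion: "completion_embedding L"
    and copies: "defect_copies L"
begin

abbreviation "U2adj \<equiv> cadj UNIV (U2 L)"

lemma lifting_props:
  "isometric_on UNIV (U1 L)" "isometric_on UNIV (U2 L)"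
  "closed_csubspace (Kplus L)" "closed_csubspace (Kminus L)"
  "csubspace (Kplus L)" "csubspace (Kminus L)"
  "k1 \<in> Kplus L \<Longrightarrow> U1 L k1 \<in> Kplus L" "k2 \<in> Kminus L \<Longrightarrow> U2adj k2 \<in> Kminus L"
  "clinear_on (Kplus L) (Xop L)"
  "k1 \<in> Kplus L \<Longrightarrow> norm (Xop L k1) \<le> 1 * norm k1"
  "k1 \<in> Kplus L \<Longrightarrow> Xop L (U1 L k1) = oproj (Kminus L) (U2 L (Xop L k1))"
  using lifting by (auto simp: lifting_problem_def unitary_def closed_csubspace_def)

section \<open>The two unitaries and the inner product on pairs\<close>

lemma U1_add: "U1 L (x + y) = U1 L x + U1 L y"
  and U1_scaleC: "U1 L (c *\<^sub>C x) = c *\<^sub>C U1 L x"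
  and cinner_U1: "cinner (U1 L x) (U1 L y) = cinner x y"
  using lifting_props(1) by (simp_all add: isometric_on_def clinear_on_def)

lemmas U2adj_add = cadj_isometric_add[OF closed_csubspace_UNIV lifting_props(2)]
lemmas U2adj_scaleC = cadj_isometric_scaleC[OF closed_csubspace_UNIV lifting_props(2)]
lemmas cinner_U2 = cadj_isometric(2)[OF closed_csubspace_UNIV lifting_props(2) UNIV_I]

lemma surj_U2: "surj (U2 L)"
  using lifting by (simp add: lifting_problem_def unitary_def)

text \<open>Since \<open>U2 L\<close> is surjective and isometric, its adjoint is its inverse and
  hence isometric as well.\<close>

lemma cinner_U2adj: "cinner (U2adj x) (U2adj y) = cinner x y"
proof -
  obtain z where z: "x = U2 L z" using surj_U2 by (metis surjD)
  have "U2adj x = z"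
    by (rule cadj_eqI) (use lifting_props(2) closed_csubspace_UNIV z in
      \<open>auto simp: isometric_on_def closed_csubspace_def\<close>)
  then show ?thesis using cinner_U2[of z y] z by simp
qed

lemma emb_linear: "clinear_on (Kminus L \<times> Kplus L) (emb L)"
  using completion by (simp add: completion_embedding_def)

lemma emb_add:
  "p \<in> Kminus L \<times> Kplus L \<Longrightarrow> q \<in> Kminus L \<times> Kplus L \<Longrightarrow> emb L (p + q) = emb L p + emb L q"
  and emb_scaleC: "p \<in> Kminus L \<times> Kplus L \<Longrightarrow> emb L (c *\<^sub>C p) = c *\<^sub>C emb L p"
  using emb_linear unfolding clinear_on_def by blast+

text \<open>The adjoint of X in the Gram matrix is moved to the other argument, so that later
  computations involve X alone.\<close>

lemma cinner_emb:
  assumes "k2 \<in> Kminus L" "k1 \<in> Kplus L" "l2 \<in> Kminus L" "l1 \<in> Kplus L"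
  shows "cinner (emb L (k2, k1)) (emb L (l2, l1)) =
    cinner k2 l2 + cinner (Xop L k1) l2 + cinner k2 (Xop L l1) + cinner k1 l1"
proof -
  have "cinner (cadj (Kplus L) (Xop L) k2) l1 = cinner k2 (Xop L l1)"
    using cadj(2)[OF lifting_props(3,9) lifting_props(10) assms(4), of k2] by (metis cinner_commute)
  then show ?thesis
    using assms completion
    by (simp add: completion_embedding_def gram_def cinner_prod_def cinner_add_left)
qed

text \<open>This is the intertwining relation in weak form: paired with a vector of
  \<open>Kminus L\<close>, the projection drops out.\<close>

lemma cinner_Xop_U1:
  assumes "k1 \<in> Kplus L" "k2 \<in> Kminus L"
  shows "cinner (Xop L (U1 L k1)) k2 = cinner (Xop L k1) (U2adj k2)"
proof -
  have "cinner (U2 L (Xop L k1) - oproj (Kminus L) (U2 L (Xop L k1))) k2 = 0"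
    using oproj(2)[OF lifting_props(4) assms(2)] .
  then show ?thesis using lifting_props(11)[OF assms(1)] by (simp add: cinner_diff_left cinner_U2)
qed

section \<open>The isometry V and its domain\<close>

abbreviation "V_graph \<equiv>
  {(emb L (k2, U1 L k1), emb L (U2adj k2, k1)) | k2 k1. k2 \<in> Kminus L \<and> k1 \<in> Kplus L}"

text \<open>In the expansion by \<open>cinner_emb\<close> the diagonal terms agree because
  \<open>U1 L\<close> and \<open>U2adj\<close> preserve inner products, and the cross terms agree by
  the intertwining relation.\<close>

lemma V_graph_isometric:
  assumes "(u, w) \<in> V_graph"
  shows "norm w = norm u"
proof -
  obtain k2 k1 where k: "k2 \<in> Kminus L" "k1 \<in> Kplus L"
    and u: "u = emb L (k2, U1 L k1)" and w: "w = emb L (U2adj k2, k1)"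
    using assms by blast
  have "cinner k2 (Xop L (U1 L k1)) = cinner (U2adj k2) (Xop L k1)"
    using cinner_Xop_U1[OF k(2,1)] by (metis cinner_commute)
  then have "cinner w w = cinner u u"
    using k by (simp add: u w cinner_emb lifting_props(7,8) cinner_U1 cinner_U2adj cinner_Xop_U1)
  then show ?thesis by (simp add: cinner_self del: of_real_power)
qed

text \<open>The graph is the image of a product of subspaces under a linear map, called
  \<open>g\<close> below.\<close>

lemma csubspace_V_graph: "csubspace V_graph"
proof -
  define g where "g = (\<lambda>(k2, k1). (emb L (k2, U1 L k1), emb L (U2adj k2, k1)))"
  have "clinear_on (Kminus L \<times> Kplus L) g"
    unfolding clinear_on_def
  proof (intro conjI ballI allI)
    fix x y assume "x \<in> Kminus L \<times> Kplus L" "y \<in> Kminus L \<times> Kplus L"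
    then show "g (x + y) = g x + g y"
      using emb_add[of "(fst x, U1 L (snd x))" "(fst y, U1 L (snd y))"]
        emb_add[of "(U2adj (fst x), snd x)" "(U2adj (fst y), snd y)"]
      by (auto simp: g_def U1_add U2adj_add lifting_props)
  next
    fix c x assume "x \<in> Kminus L \<times> Kplus L"
    then show "g (c *\<^sub>C x) = c *\<^sub>C g x"
      using emb_scaleC[of "(fst x, U1 L (snd x))" c] emb_scaleC[of "(U2adj (fst x), snd x)" c]
      by (auto simp: g_def U1_scaleC U2adj_scaleC lifting_props scaleC_prod_def)
  qed
  then have "csubspace (g ` (Kminus L \<times> Kplus L))"
    by (intro csubspace_image csubspace_Times lifting_props)
  moreover have "g ` (Kminus L \<times> Kplus L) = V_graph" unfolding g_def by auto
  ultimately show ?thesis by simp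
qed

lemma Dom_eq: "Dom L = closure (fst ` V_graph)"
proof -
  have "fst ` V_graph = emb L ` (Kminus L \<times> U1 L ` Kplus L)" by force
  then show ?thesis by (simp add: Dom_def)
qed

lemma Vop_linear: "clinear_on (Dom L) (Vop L)"
  and norm_Vop: "d \<in> Dom L \<Longrightarrow> norm (Vop L d) = norm d"
  using isometric_graph_closure[OF csubspace_V_graph V_graph_isometric]
  unfolding Dom_eq Vop_def by blast+

lemma closed_csubspace_Dom: "closed_csubspace (Dom L)"
proof -
  have U: "U1 L ` Kplus L \<subseteq> Kplus L" using lifting_props(7) by blast
  have "clinear_on (Kplus L) (U1 L)"
    using lifting_props(1) clinear_on_subset[OF _ subset_UNIV] by (auto simp: isometric_on_def)
  then show ?thesis
    unfolding Dom_def using U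
    by (intro closed_csubspace_closure csubspace_image csubspace_Times lifting_props
        clinear_on_subset[OF emb_linear]) auto
qed

section \<open>The state operator and its adjoint\<close>

lemma closed_csubspace_H0: "closed_csubspace (H0 L)"
  unfolding H0_def
  by (intro closed_csubspace_closure csubspace_image csubspace_Times lifting_props emb_linear)

text \<open>V is known to be linear only on \<open>Dom L\<close>, but the projection always lands
  there, so any \<open>S\<close> is allowed.\<close>

lemma A0_linear: "clinear_on S (A0 L)"
  using Vop_linear oproj(1)[OF closed_csubspace_Dom]
  by (simp add: clinear_on_def A0_def oproj_add oproj_scaleC closed_csubspace_Dom)

text \<open>The factor 1 matches the shape \<open>B * norm s\<close> of the bound in
  \<open>cadj\<close>.\<close>

lemma norm_A0_le: "norm (A0 L h) \<le> 1 * norm h"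
  using norm_oproj_le[OF closed_csubspace_Dom] oproj(1)[OF closed_csubspace_Dom]
  by (simp add: A0_def norm_Vop)

abbreviation "A0adj \<equiv> cadj (H0 L) (A0 L)"

lemmas A0adj_mem = cadj(1)[OF closed_csubspace_H0 A0_linear norm_A0_le]
lemmas cinner_A0 = cadj(2)[OF closed_csubspace_H0 A0_linear norm_A0_le]

section \<open>Defect spaces and the output operator\<close>

lemma Del: "closed_csubspace (Del L)" "csubspace (Del L)" "isometric_on (Del L) (iDel L)"
  and Dels: "closed_csubspace (Dels L)" "csubspace (Dels L)" "isometric_on (Dels L) (iDels L)"
  using copies by (auto simp: defect_copies_def closed_csubspace_def)

lemma iDel_defect: "s \<in> Del L \<Longrightarrow> iDel L s \<in> defect L"
  using copies by (auto simp: defect_copies_def)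

lemma iDels_zero: "iDels L 0 = 0"
  using Dels(2,3) by (auto simp: isometric_on_def csubspace_def intro: clinear_on_zero)

lemma A0_defect: "h \<in> defect L \<Longrightarrow> A0 L h = 0"
proof -
  assume h: "h \<in> defect L"
  have D: "csubspace (Dom L)" "0 \<in> Dom L"
    using closed_csubspace_Dom by (auto simp: closed_csubspace_def csubspace_def)
  have "oproj (Dom L) h = 0"
    using h D by (intro oproj_eqI) (auto simp: defect_def)
  then show "A0 L h = 0"
    using clinear_on_zero[OF Vop_linear D(2)] by (simp add: A0_def)
qed

lemma iDel_adj_eq_0: "cadj (Del L) (iDel L) h = 0" if "\<And>k. k \<in> defect L \<Longrightarrow> cinner k h = 0"
  using Del(2) that iDel_defect by (intro cadj_eqI) (auto simp: csubspace_def)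

text \<open>Pairing with a defect vector moves \<open>A0 L\<close> onto that vector, which it
  annihilates.\<close>

lemma iDel_adj_A0adj: "cadj (Del L) (iDel L) (A0adj h) = 0"
proof (rule iDel_adj_eq_0)
  fix k assume k: "k \<in> defect L"
  then have "k \<in> H0 L" by (simp add: defect_def)
  then have "cinner k (A0adj h) = cinner (A0 L k) h" by (simp add: cinner_A0)
  then show "cinner k (A0adj h) = 0" using A0_defect[OF k] by simp
qed

text \<open>The component in \<open>Dom L\<close> is orthogonal to the defect space, so the adjoint
  of \<open>iDel L\<close> does not see it. This identifies the output operator with the
  corresponding block of \<open>U0adj\<close>.\<close>

lemma C0_eq: "C0 L h = cadj (Del L) (iDel L) h"
proof -
  have "cadj (Del L) (iDel L) (oproj (Dom L) h) = 0"
    using oproj(1)[OF closed_csubspace_Dom] by (intro iDel_adj_eq_0) (auto simp: defect_def)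
  then show ?thesis
    using cadj_isometric_add[OF Del(1,3), of "h - oproj (Dom L) h" "oproj (Dom L) h"]
    by (simp add: C0_def)
qed

section \<open>Adjoint embeddings and nonnegative powers\<close>

text \<open>The zero entries of the embedding contribute nothing to the inner product, so both
  adjoints have the same defining condition.\<close>

lemma cadj_iG2_0: "cadj S (iG2_0 L) (h, x, y) = cadj S (iG2 L) h"
  by (simp add: cadj_def iG2_0_def cinner_prod_def)

lemma cadj_iDel_0: "coord x (-1) \<in> Del L \<Longrightarrow> cadj (Del L) (iDel_0 L) (h, x, y) = coord x (-1)"
  by (rule cadj_eqI) (simp_all add: Del iDel_0_def cinner_prod_def cinner_single_left)

text \<open>\<open>Jminus_adj\<close> leaves a zero at index -1, so only the value newly inserted
  from \<open>h\<close> is read there. This is why the second row of the formula carries an extra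
  \<open>U0adj\<close>.\<close>

lemma cadj_iDel_0_U0adj:
  "cadj (Del L) (iDel_0 L) (U0adj L (h, x, y)) = cadj (Del L) (iDel L) h"
  using cadj_isometric(1)[OF Del(1,3), of h]
  by (simp add: U0adj_def cadj_iDel_0 plus_ell2.rep_eq coord_single Jminus_adj.rep_eq)

lemma cadj_single_Dels: "coord y 0 \<in> Dels L \<Longrightarrow> cadj (Dels L) (ell2_single 0) y = coord y 0"
  using cadj_single Dels(2) .

lemma zero_mem_Dels: "0 \<in> Dels L"
  using Dels(2) by (simp add: csubspace_def)

text \<open>A zero third component feeds nothing into the first. The sequence \<open>x\<close> may
  stay unspecified because it never flows back.\<close>

lemma U0adj_funpow: "\<exists>x. (U0adj L ^^ m) (h, 0, 0) = ((A0 L ^^ m) h, x, 0)"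
  by (induction m) (auto simp: U0adj_def cadj_single_Dels zero_mem_Dels iDels_zero)

text \<open>One step consumes the pulse at index 0 and turns it into a state; this accounts for the
  exponent \<open>n - 1\<close> in the second column.\<close>

lemma U0adj_iDels_0:
  assumes "e \<in> Dels L"
  shows "U0adj L (iDels_0 L e) = (B0 L e, 0, 0)"
proof -
  have "A0 L 0 = 0" using clinear_on_zero[OF A0_linear[of UNIV]] by simp
  moreover have "cadj (Del L) (iDel L) 0 = 0" by (rule cadj_zero[OF Del(2)])
  ultimately show ?thesis
    using assms by (simp add: U0adj_def iDels_0_def B0_def cadj_single_Dels coord_single)
qed

section \<open>Negative powers\<close>

lemma csubspace_K0: "csubspace (K0 L)"
  using closed_csubspace_H0 Del(2) Dels(2)
  by (auto simp: csubspace_def K0_def closed_csubspace_def zero_prod_def scaleC_prod_def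
      plus_ell2.rep_eq scaleC_ell2.rep_eq)

text \<open>The third summand of \<open>K0 L\<close>.\<close>

definition plus_seqs :: "'e ell2 set" where
  "plus_seqs = {y. (\<forall>n. coord y n \<in> Dels L) \<and> (\<forall>n<0. coord y n = 0)}"

text \<open>The claimed value lies in \<open>K0 L\<close> and satisfies the adjoint identity against
  every vector of \<open>K0 L\<close>, which determines it. The second component of such a vector
  drops out, since both right-hand arguments are zero there.\<close>

lemma U0_apply:
  fixes h :: 'h and y :: "'e ell2"
  assumes y: "y \<in> plus_seqs"
  defines "y' \<equiv> ell2_single 0 (cadj (Dels L) (iDels L) h) + ell2_rshift y"
  shows "U0 L (h, 0, y) = (A0adj h, 0, y')" and "y' \<in> plus_seqs"
proof -
  show y': "y' \<in> plus_seqs"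
    using y Dels(2) cadj_isometric(1)[OF Dels(1,3)]
    by (auto simp: plus_seqs_def y'_def plus_ell2.rep_eq coord_single ell2_rshift.rep_eq
        csubspace_def)
  show "U0 L (h, 0, y) = (A0adj h, 0, y')"
    unfolding U0_def
  proof (rule cadj_eqI)
    show "csubspace (K0 L)" by (rule csubspace_K0)
    show "(A0adj h, 0, y') \<in> K0 L"
      using y' A0adj_mem Del(2) by (auto simp: K0_def plus_seqs_def csubspace_def)
    fix s assume "s \<in> K0 L"
    then obtain k x z where s: "s = (k, x, z)" and k: "k \<in> H0 L" and z: "coord z 0 \<in> Dels L"
      by (auto simp: K0_def)
    have "cinner (iDels L (coord z 0)) h = cinner (coord z 0) (cadj (Dels L) (iDels L) h)"
      using cadj_isometric(2)[OF Dels(1,3) z] .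
    then show "cinner (U0adj L s) (h, 0, y) = cinner s (A0adj h, 0, y')"
      using y k z
      by (simp add: s U0adj_def cinner_prod_def y'_def cinner_add_left cinner_add_right
          cadj_single_Dels cinner_single_right cinner_Jplus_adj cinner_A0 plus_seqs_def)
  qed
qed

text \<open>Membership of the new sequence in \<open>plus_seqs\<close> keeps the induction going.
  Its exact value is irrelevant, as only the first component is read later.\<close>

lemma U0_funpow:
  "y \<in> plus_seqs \<Longrightarrow> \<exists>z\<in>plus_seqs. (U0 L ^^ m) (h, 0, y) = ((A0adj ^^ m) h, 0, z)"
  by (induction m) (auto simp: U0_apply)

lemma A0adj_funpow_zero: "(A0adj ^^ m) 0 = 0"
  using closed_csubspace_H0 by (induction m) (simp_all add: cadj_zero closed_csubspace_def)

section \<open>The two columns of the symbol\<close>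

lemma symbol_column1:
  shows "redh_s0 L n g = cadj (G2 L) (iG2_0 L) (U0adj_pow L n (iG1_0 L g))
    \<and> redh_s1 L n g = cadj (Del L) (iDel_0 L) (U0adj L (U0adj_pow L n (iG1_0 L g)))"
proof (cases "n \<ge> 0")
  case True
  obtain x where "(U0adj L ^^ nat n) (iG1_0 L g) = ((A0 L ^^ nat n) (iG1 L g), x, 0)"
    using U0adj_funpow unfolding iG1_0_def by blast
  with True show ?thesis
    by (simp add: U0adj_pow_def redh_s0_def redh_s1_def cadj_iG2_0 cadj_iDel_0_U0adj C0_eq)
next
  case False
  \<comment> \<open>Writing the exponent as a successor exposes an outermost \<open>A0adj\<close>,
    to which \<open>iDel_adj_A0adj\<close> applies.\<close>
  then obtain m where m: "nat (- n) = Suc m" by (cases "nat (- n)") auto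
  have "0 \<in> plus_seqs" by (simp add: plus_seqs_def zero_mem_Dels)
  then obtain z where
    "(U0 L ^^ nat \<bar>n\<bar>) (iG1_0 L g) = ((A0adj ^^ nat \<bar>n\<bar>) (iG1 L g), 0, z)"
    using U0_funpow unfolding iG1_0_def by blast
  with False show ?thesis
    by (simp add: U0adj_pow_def redh_s0_def redh_s1_def cadj_iG2_0 cadj_iDel_0_U0adj m
        iDel_adj_A0adj)
qed

lemma symbol_column2:
  assumes e: "e \<in> Dels L" and G2: "csubspace (G2 L)"
  shows "redh_s2 L n e = cadj (G2 L) (iG2_0 L) (U0adj_pow L n (iDels_0 L e))
    \<and> redh_s L n e = cadj (Del L) (iDel_0 L) (U0adj L (U0adj_pow L n (iDels_0 L e)))"
proof (cases "n \<ge> 1")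
  case True
  \<comment> \<open>One of the \<open>n\<close> powers is split off to carry \<open>e\<close> into
    the state space by \<open>U0adj_iDels_0\<close>.\<close>
  then have m: "nat n = Suc (nat (n - 1))" by simp
  obtain x where "(U0adj L ^^ nat n) (iDels_0 L e) = ((A0 L ^^ nat (n - 1)) (B0 L e), x, 0)"
    using U0adj_funpow[of "nat (n - 1)" "B0 L e"] e
    by (auto simp: m funpow_Suc_right U0adj_iDels_0 simp del: funpow.simps)
  with True show ?thesis
    by (simp add: U0adj_pow_def redh_s2_def redh_s_def cadj_iG2_0 cadj_iDel_0_U0adj C0_eq)
next
  case False
  have "ell2_single 0 e \<in> plus_seqs"
    using e by (simp add: plus_seqs_def coord_single zero_mem_Dels)
  \<comment> \<open>The first component starts at 0, and powers of \<open>A0adj\<close> keep it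
    there.\<close>
  then obtain z where "(U0 L ^^ nat \<bar>n\<bar>) (iDels_0 L e) = (0, 0, z)"
    using U0_funpow[of _ "nat \<bar>n\<bar>" 0] by (auto simp: iDels_0_def A0adj_funpow_zero)
  \<comment> \<open>At \<open>n = 0\<close> the definition takes a power of \<open>U0adj\<close>,
    but the zeroth powers of \<open>U0adj\<close> and \<open>U0\<close> are both the
    identity.\<close>
  then have "U0adj_pow L n (iDels_0 L e) = (0, 0, z)"
    using False by (cases "n = 0") (auto simp: U0adj_pow_def)
  moreover have "cadj (Del L) (iDel L) 0 = 0" by (rule cadj_zero[OF Del(2)])
  ultimately show ?thesis
    using False
    by (simp add: redh_s2_def redh_s_def cadj_iG2_0 cadj_iDel_0_U0adj cadj_zero[OF G2])
qed

end

theorem theorem8p6: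
  fixes L :: "('a::chilbert_space, 'b::chilbert_space, 'h::chilbert_space,
               'd::chilbert_space, 'e::chilbert_space) lifting_data"
  assumes "lifting_problem L"
    and "coefficient_spaces L"
    and "completion_embedding L"
    and "defect_copies L"
  shows "(\<forall>n. \<forall>g\<in>G1 L.
            redh_s0 L n g = cadj (G2 L) (iG2_0 L) (U0adj_pow L n (iG1_0 L g)) \<and>
            redh_s1 L n g = cadj (Del L) (iDel_0 L) (U0adj L (U0adj_pow L n (iG1_0 L g)))) \<and>
         (\<forall>n. \<forall>e\<in>Dels L.
            redh_s2 L n e = cadj (G2 L) (iG2_0 L) (U0adj_pow L n (iDels_0 L e)) \<and>
            redh_s L n e = cadj (Del L) (iDel_0 L) (U0adj L (U0adj_pow L n (iDels_0 L e)))) \<and>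
         (\<forall>n\<le>0. \<forall>e\<in>Dels L. redh_s2 L n e = 0) \<and>
         (\<forall>n<0. \<forall>g\<in>G1 L. redh_s1 L n g = 0) \<and>
         (\<forall>n<0. \<forall>e\<in>Dels L. redh_s L n e = 0) \<and>
         (\<forall>e\<in>Dels L. redh_s L 0 e = 0)"
proof -
  interpret lifting_model L
    using assms(1,3,4) by unfold_locales
  have "csubspace (G2 L)"
    using assms(2) by (simp add: coefficient_spaces_def closed_csubspace_def)
  \<comment> \<open>The vanishing claims are built into the definitions of the symbol; the column
    formulas show that the extension produces the same zeros.\<close>
  then show ?thesis
    using symbol_column1 symbol_column2 by (auto simp: redh_s2_def redh_s1_def redh_s_def)
qed

end
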